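(* Let $p$ be a prime. Then every connected Cayley graph on the dihedral group $D_{2p}$ has a Hamilton decomposition. That is, for every subset $S\subseteq D_{2p}$ with $1\notin S$, $S=S^{-1}$ and $\langle S\rangle=D_{2p}$, the Cayley graph $Cay(D_{2p},S)$ has a Hamilton decomposition.
   Context: For $n\geqslant 2$, the dihedral group $D_{2n}$ is the group generated by two elements $\alpha,\beta$ subject to $\alpha^n=\beta^2=1$ and $\beta\alpha\beta=\alpha^{-1}$. For a group $G$ and a subset $S\subseteq G$ with $1\notin S$, $S=S^{-1}=\{s^{-1}: s\in S\}$ and $\langle S\rangle=G$, the Cayley graph $Cay(G,S)$ is the simple graph with vertex set $G$ in which $g,h\in G$ are adjacent iff $hg^{-1}\in S$; it is regular of valency $|S|$. A regular graph of valency $2k$ has a Hamilton decomposition if its edge set can be partitioned into $k$ Hamilton cycles; a regular graph of valency $2k-1$ has a Hamilton decomposition if its edge set can be partitioned into $k-1$ Hamilton cycles and a perfect matching (here $k\geqslant 1$; in particular a connected $2$-regular graph, being a Hamilton cycle, has a Hamilton decomposition). *)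

theory Defs
  imports "HOL-Algebra.Algebra" "HOL-Library.Disjoint_Sets" "HOL-Computational_Algebra.Primes"
begin

section \<open>The dihedral group of order \<open>2n\<close>\<close>

text \<open>
  The pair \<open>(i, s)\<close> stands for the normal form \<open>\<alpha>\<^sup>i\<close> if \<open>s\<close> is false and \<open>\<alpha>\<^sup>i \<beta>\<close> if \<open>s\<close> is
  true, the exponent being taken modulo \<open>n\<close>; the product is dictated by \<open>\<beta> \<alpha>\<^sup>j = \<alpha>\<^sup>-\<^sup>j \<beta>\<close>.
  The lemmas \<open>dihedral_relations\<close>, \<open>dihedral_generated\<close> and \<open>dihedral_universal\<close> show that
  this is the group presented by \<open>\<langle>\<alpha>, \<beta> | \<alpha>\<^sup>n = \<beta>\<^sup>2 = 1, \<beta> \<alpha> \<beta> = \<alpha>\<^sup>-\<^sup>1\<rangle>\<close>.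
\<close>

definition dihedral :: "nat \<Rightarrow> (int \<times> bool) monoid" where
  "dihedral n =
     \<lparr>carrier = {0..<int n} \<times> UNIV,
      monoid.mult = (\<lambda>(i, s) (j, t). ((if s then i - j else i + j) mod int n, s \<noteq> t)),
      monoid.one = (0, False)\<rparr>"

definition dih_alpha :: "nat \<Rightarrow> int \<times> bool" where
  "dih_alpha n = (1 mod int n, False)"

definition dih_beta :: "nat \<Rightarrow> int \<times> bool" where
  "dih_beta n = (0, True)"

lemma dihedral_group:
  assumes "n > 0"
  shows "group (dihedral n)"
proof (rule groupI)
  fix x y assume "x \<in> carrier (dihedral n)" "y \<in> carrier (dihedral n)"
  then show "x \<otimes>\<^bsub>dihedral n\<^esub> y \<in> carrier (dihedral n)"
    using assms by (auto simp: dihedral_def)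
next
  show "\<one>\<^bsub>dihedral n\<^esub> \<in> carrier (dihedral n)"
    using assms by (auto simp: dihedral_def)
next
  fix x y z
  show "x \<otimes>\<^bsub>dihedral n\<^esub> y \<otimes>\<^bsub>dihedral n\<^esub> z = x \<otimes>\<^bsub>dihedral n\<^esub> (y \<otimes>\<^bsub>dihedral n\<^esub> z)"
    by (cases x; cases y; cases z)
      (simp add: dihedral_def mod_diff_left_eq mod_diff_right_eq mod_add_left_eq mod_add_right_eq
        diff_diff_eq diff_diff_eq2 add_diff_eq diff_add_eq add.assoc)
next
  fix x assume "x \<in> carrier (dihedral n)"
  then show "\<one>\<^bsub>dihedral n\<^esub> \<otimes>\<^bsub>dihedral n\<^esub> x = x"
    by (auto simp: dihedral_def)
next
  fix x assume x: "x \<in> carrier (dihedral n)"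
  obtain i s where [simp]: "x = (i, s)" by fastforce
  show "\<exists>y\<in>carrier (dihedral n). y \<otimes>\<^bsub>dihedral n\<^esub> x = \<one>\<^bsub>dihedral n\<^esub>"
    using x assms
    by (intro bexI[of _ "if s then (i, True) else ((- i) mod int n, False)"])
      (auto simp: dihedral_def mod_simps)
qed

lemma dihedral_order: "order (dihedral n) = 2 * n"
  by (simp add: order_def dihedral_def card_cartesian_product)

lemma dihedral_alpha_pow:
  "dih_alpha n [^]\<^bsub>dihedral n\<^esub> (k::nat) = (int k mod int n, False)"
  by (induction k) (auto simp: dihedral_def dih_alpha_def mod_simps add.commute)

lemma dihedral_relations:
  assumes "n > 0"
  shows "dih_alpha n \<in> carrier (dihedral n)"
    and "dih_beta n \<in> carrier (dihedral n)"
    and "dih_alpha n [^]\<^bsub>dihedral n\<^esub> n = \<one>\<^bsub>dihedral n\<^esub>"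
    and "dih_beta n [^]\<^bsub>dihedral n\<^esub> (2::nat) = \<one>\<^bsub>dihedral n\<^esub>"
    and "dih_beta n \<otimes>\<^bsub>dihedral n\<^esub> dih_alpha n \<otimes>\<^bsub>dihedral n\<^esub> dih_beta n
           = inv\<^bsub>dihedral n\<^esub> dih_alpha n"
proof -
  interpret D: group "dihedral n" using dihedral_group[OF assms] .
  show a: "dih_alpha n \<in> carrier (dihedral n)" and b: "dih_beta n \<in> carrier (dihedral n)"
    using assms by (auto simp: dihedral_def dih_alpha_def dih_beta_def)
  show "dih_alpha n [^]\<^bsub>dihedral n\<^esub> n = \<one>\<^bsub>dihedral n\<^esub>"
    unfolding dihedral_alpha_pow by (simp add: dihedral_def)
  show "dih_beta n [^]\<^bsub>dihedral n\<^esub> (2::nat) = \<one>\<^bsub>dihedral n\<^esub>"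
    by (simp add: numeral_2_eq_2 dihedral_def dih_beta_def)
  have "(dih_beta n \<otimes>\<^bsub>dihedral n\<^esub> dih_alpha n \<otimes>\<^bsub>dihedral n\<^esub> dih_beta n)
          \<otimes>\<^bsub>dihedral n\<^esub> dih_alpha n = \<one>\<^bsub>dihedral n\<^esub>"
    by (simp add: dihedral_def dih_alpha_def dih_beta_def mod_simps)
  then show "dih_beta n \<otimes>\<^bsub>dihedral n\<^esub> dih_alpha n \<otimes>\<^bsub>dihedral n\<^esub> dih_beta n
           = inv\<^bsub>dihedral n\<^esub> dih_alpha n"
    using a b by (metis D.inv_equality D.m_closed)
qed

lemma dihedral_normal_form:
  assumes "(i, s) \<in> carrier (dihedral n)"
  shows "(i, s) = dih_alpha n [^]\<^bsub>dihedral n\<^esub> nat i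
           \<otimes>\<^bsub>dihedral n\<^esub> (if s then dih_beta n else \<one>\<^bsub>dihedral n\<^esub>)"
  using assms unfolding dihedral_alpha_pow by (auto simp: dihedral_def dih_beta_def)

lemma dihedral_generated:
  assumes "n > 0"
  shows "generate (dihedral n) {dih_alpha n, dih_beta n} = carrier (dihedral n)"
proof -
  interpret D: group "dihedral n" using dihedral_group[OF assms] .
  let ?H = "generate (dihedral n) {dih_alpha n, dih_beta n}"
  have sub: "subgroup ?H (dihedral n)"
    using dihedral_relations(1,2)[OF assms] by (intro D.generate_is_subgroup) auto
  have pow: "dih_alpha n [^]\<^bsub>dihedral n\<^esub> (k::nat) \<in> ?H" for k
    by (induction k) (auto intro: generate.intros)
  have "carrier (dihedral n) \<subseteq> ?H"
  proof
    fix x assume x: "x \<in> carrier (dihedral n)"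
    obtain i s where xi: "x = (i, s)" by fastforce
    have mem: "(if s then dih_beta n else \<one>\<^bsub>dihedral n\<^esub>) \<in> ?H"
      by (auto intro: generate.intros)
    show "x \<in> ?H"
      using x unfolding xi by (subst dihedral_normal_form, assumption) (intro generate.eng pow mem)
  qed
  then show ?thesis
    using subgroup.subset[OF sub] by blast
qed

lemma dihedral_universal:
  assumes "n > 0" "group H" "a \<in> carrier H" "b \<in> carrier H"
    and an: "a [^]\<^bsub>H\<^esub> n = \<one>\<^bsub>H\<^esub>" and b2: "b [^]\<^bsub>H\<^esub> (2::nat) = \<one>\<^bsub>H\<^esub>"
    and bab: "b \<otimes>\<^bsub>H\<^esub> a \<otimes>\<^bsub>H\<^esub> b = inv\<^bsub>H\<^esub> a"
  shows "\<exists>f \<in> hom (dihedral n) H. f (dih_alpha n) = a \<and> f (dih_beta n) = b"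
proof -
  interpret H: group H by fact
  note [simp] = \<open>a \<in> carrier H\<close> \<open>b \<in> carrier H\<close>
  define f where "f = (\<lambda>(i::int, s). a [^]\<^bsub>H\<^esub> i \<otimes>\<^bsub>H\<^esub> (if s then b else \<one>\<^bsub>H\<^esub>))"
  have bb: "b \<otimes>\<^bsub>H\<^esub> b = \<one>\<^bsub>H\<^esub>"
    using b2 by (simp add: numeral_2_eq_2)
  have per: "a [^]\<^bsub>H\<^esub> (i mod int n) = a [^]\<^bsub>H\<^esub> i" for i :: int
  proof -
    have "a [^]\<^bsub>H\<^esub> i = a [^]\<^bsub>H\<^esub> (int n * (i div int n) + i mod int n)"
      by simp
    also have "\<dots> = (a [^]\<^bsub>H\<^esub> int n) [^]\<^bsub>H\<^esub> (i div int n) \<otimes>\<^bsub>H\<^esub> a [^]\<^bsub>H\<^esub> (i mod int n)"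
      by (simp only: H.int_pow_mult H.int_pow_pow \<open>a \<in> carrier H\<close>)
    also have "\<dots> = a [^]\<^bsub>H\<^esub> (i mod int n)"
      using an by (simp add: int_pow_int)
    finally show ?thesis ..
  qed
  have conj: "b \<otimes>\<^bsub>H\<^esub> a [^]\<^bsub>H\<^esub> j = a [^]\<^bsub>H\<^esub> (- j) \<otimes>\<^bsub>H\<^esub> b" for j :: int
  proof -
    have nat: "b \<otimes>\<^bsub>H\<^esub> c [^]\<^bsub>H\<^esub> k = (inv\<^bsub>H\<^esub> c) [^]\<^bsub>H\<^esub> k \<otimes>\<^bsub>H\<^esub> b"
      if c: "c \<in> carrier H" "b \<otimes>\<^bsub>H\<^esub> c = inv\<^bsub>H\<^esub> c \<otimes>\<^bsub>H\<^esub> b" for c and k :: nat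
    proof (induction k)
      case (Suc k)
      have "b \<otimes>\<^bsub>H\<^esub> c [^]\<^bsub>H\<^esub> Suc k = (inv\<^bsub>H\<^esub> c) [^]\<^bsub>H\<^esub> k \<otimes>\<^bsub>H\<^esub> (b \<otimes>\<^bsub>H\<^esub> c)"
        using Suc c(1) by (simp add: H.m_assoc[symmetric])
      then show ?case
        using c by (simp add: H.m_assoc)
    qed (use c in auto)
    have ba: "b \<otimes>\<^bsub>H\<^esub> a = inv\<^bsub>H\<^esub> a \<otimes>\<^bsub>H\<^esub> b"
      using bab bb H.m_assoc[of "b \<otimes>\<^bsub>H\<^esub> a" b b] by simp
    have ba': "b \<otimes>\<^bsub>H\<^esub> inv\<^bsub>H\<^esub> a = inv\<^bsub>H\<^esub> (inv\<^bsub>H\<^esub> a) \<otimes>\<^bsub>H\<^esub> b"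
    proof -
      have "b = a \<otimes>\<^bsub>H\<^esub> b \<otimes>\<^bsub>H\<^esub> a"
        by (simp add: H.m_assoc ba) (simp add: H.m_assoc[symmetric])
      then show ?thesis
        by (simp add: H.inv_solve_right')
    qed
    show ?thesis
    proof (cases j)
      case (nonneg k)
      then show ?thesis
        using nat[OF _ ba, of k] by (simp add: H.int_pow_neg int_pow_int H.nat_pow_inv)
    next
      case (neg k)
      then obtain m where "j = - int m" by blast
      then show ?thesis
        using nat[OF _ ba', of m] by (simp add: H.int_pow_neg int_pow_int H.nat_pow_inv)
    qed
  qed
  have "f \<in> hom (dihedral n) H"
  proof (rule homI)
    fix x y assume "x \<in> carrier (dihedral n)" "y \<in> carrier (dihedral n)"
    obtain i s j t where [simp]: "x = (i, s)" "y = (j, t)" by fastforce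
    show "f (x \<otimes>\<^bsub>dihedral n\<^esub> y) = f x \<otimes>\<^bsub>H\<^esub> f y"
    proof (cases s)
      case False
      then show ?thesis
        by (auto simp: f_def dihedral_def per H.int_pow_mult H.m_assoc)
    next
      case True
      have *: "b \<otimes>\<^bsub>H\<^esub> (a [^]\<^bsub>H\<^esub> j \<otimes>\<^bsub>H\<^esub> c) = a [^]\<^bsub>H\<^esub> (- j) \<otimes>\<^bsub>H\<^esub> (b \<otimes>\<^bsub>H\<^esub> c)"
        if "c \<in> carrier H" for c
        using conj[of j] that by (simp add: H.m_assoc[symmetric])
      have "a [^]\<^bsub>H\<^esub> (i - j) = a [^]\<^bsub>H\<^esub> i \<otimes>\<^bsub>H\<^esub> a [^]\<^bsub>H\<^esub> (- j)"
        using H.int_pow_mult[of a i "- j"] by simp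
      then show ?thesis
        using True
        by (auto simp: f_def dihedral_def per H.m_assoc * bb conj simp del: H.int_pow_neg)
    qed
  qed (auto simp: f_def)
  moreover have "f (dih_alpha n) = a" "f (dih_beta n) = b"
    by (simp_all add: f_def dih_alpha_def dih_beta_def per)
  ultimately show ?thesis by blast
qed


section \<open>Simple graphs and Hamilton decompositions\<close>

text \<open>The edges of a simple graph are two-element subsets of its vertex set.\<close>

record 'a sgraph =
  verts :: "'a set"
  edges :: "'a set set"

definition simple_graph :: "'a sgraph \<Rightarrow> bool" where
  "simple_graph \<Gamma> \<longleftrightarrow> (\<forall>e \<in> edges \<Gamma>. e \<subseteq> verts \<Gamma> \<and> card e = 2)"

definition valency :: "'a sgraph \<Rightarrow> 'a \<Rightarrow> nat" where
  "valency \<Gamma> v = card {e \<in> edges \<Gamma>. v \<in> e}"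

definition regular_graph :: "'a sgraph \<Rightarrow> nat \<Rightarrow> bool" where
  "regular_graph \<Gamma> d \<longleftrightarrow> (\<forall>v \<in> verts \<Gamma>. valency \<Gamma> v = d)"

definition cycle_edges :: "'a list \<Rightarrow> 'a set set" where
  "cycle_edges vs = {{vs ! i, vs ! (Suc i mod length vs)} | i. i < length vs}"

text \<open>Hamilton cycles and perfect matchings are represented by their edge sets.\<close>

definition hamilton_cycle :: "'a sgraph \<Rightarrow> 'a set set \<Rightarrow> bool" where
  "hamilton_cycle \<Gamma> C \<longleftrightarrow>
     C \<subseteq> edges \<Gamma> \<and>
     (\<exists>vs. distinct vs \<and> length vs \<ge> 3 \<and> set vs = verts \<Gamma> \<and> C = cycle_edges vs)"

definition perfect_matching :: "'a sgraph \<Rightarrow> 'a set set \<Rightarrow> bool" where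
  "perfect_matching \<Gamma> M \<longleftrightarrow> M \<subseteq> edges \<Gamma> \<and> (\<forall>v \<in> verts \<Gamma>. \<exists>!e. e \<in> M \<and> v \<in> e)"

text \<open>The conjunct \<open>finite \<C>\<close> matters only for \<open>k = 1\<close>, as infinite sets have cardinality \<open>0\<close>.\<close>

definition hamilton_decomposition :: "'a sgraph \<Rightarrow> bool" where
  "hamilton_decomposition \<Gamma> \<longleftrightarrow>
     (\<exists>k \<ge> 1.
        regular_graph \<Gamma> (2 * k) \<and>
        (\<exists>\<C>. finite \<C> \<and> card \<C> = k \<and> (\<forall>C \<in> \<C>. hamilton_cycle \<Gamma> C) \<and>
             partition_on (edges \<Gamma>) \<C>)
      \<or>
        regular_graph \<Gamma> (2 * k - 1) \<and>
        (\<exists>\<C> M. finite \<C> \<and> card \<C> = k - 1 \<and> (\<forall>C \<in> \<C>. hamilton_cycle \<Gamma> C) \<and>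
               perfect_matching \<Gamma> M \<and> M \<notin> \<C> \<and> partition_on (edges \<Gamma>) (insert M \<C>)))"


section \<open>Cayley graphs\<close>

text \<open>
  The graph is meaningful if \<open>S \<subseteq> carrier G\<close>, \<open>\<one> \<notin> S\<close> (no loops) and \<open>S\<close> is closed under
  inverses (adjacency is symmetric); it is connected iff \<open>S\<close> generates \<open>G\<close>.
\<close>

definition cayley_graph :: "('a, 'b) monoid_scheme \<Rightarrow> 'a set \<Rightarrow> 'a sgraph" where
  "cayley_graph G S =
     \<lparr>verts = carrier G,
      edges = {{g, h} | g h. g \<in> carrier G \<and> h \<in> carrier G \<and> h \<otimes>\<^bsub>G\<^esub> inv\<^bsub>G\<^esub> g \<in> S}\<rparr>"

lemma (in group) cayley_graph_adj:
  assumes "S \<subseteq> carrier G" "S = set_inv S" "g \<in> carrier G" "h \<in> carrier G"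
  shows "{g, h} \<in> edges (cayley_graph G S) \<longleftrightarrow> h \<otimes> inv g \<in> S"
proof -
  have "y \<otimes> inv x \<in> S" if "x \<otimes> inv y \<in> S" "x \<in> carrier G" "y \<in> carrier G" for x y
  proof -
    have "inv (x \<otimes> inv y) \<in> S"
      using that(1) assms(2) unfolding SET_INV_def by blast
    then show ?thesis
      using that(2,3) by (simp add: inv_mult_group)
  qed
  then show ?thesis
    using assms(3,4) by (auto simp: cayley_graph_def doubleton_eq_iff)
qed

lemma (in group) cayley_graph_simple:
  assumes "\<one> \<notin> S"
  shows "simple_graph (cayley_graph G S)"
proof -
  have "g \<noteq> h" if "g \<in> carrier G" "h \<otimes> inv g \<in> S" for g h
    using that assms by auto
  then show ?thesis
    by (auto simp: simple_graph_def cayley_graph_def card_2_iff) 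
qed

lemma (in group) cayley_graph_regular:
  assumes "S \<subseteq> carrier G" "\<one> \<notin> S" "S = set_inv S"
  shows "regular_graph (cayley_graph G S) (card S)"
  unfolding regular_graph_def
proof
  fix g assume "g \<in> verts (cayley_graph G S)"
  then have g: "g \<in> carrier G" by (simp add: cayley_graph_def)
  have "bij_betw (\<lambda>s. {g, s \<otimes> g}) S {e \<in> edges (cayley_graph G S). g \<in> e}"
    unfolding bij_betw_def
  proof
    show "inj_on (\<lambda>s. {g, s \<otimes> g}) S"
      using assms(1) g by (auto intro!: inj_onI simp: doubleton_eq_iff subset_iff)
    show "(\<lambda>s. {g, s \<otimes> g}) ` S = {e \<in> edges (cayley_graph G S). g \<in> e}" (is "?L = ?R")
    proof
      show "?L \<subseteq> ?R"
        using assms g by (auto simp: cayley_graph_adj m_assoc subset_iff)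
      show "?R \<subseteq> ?L"
      proof
        fix e assume e: "e \<in> ?R"
        then obtain h where h: "e = {g, h}" "h \<in> carrier G"
          unfolding cayley_graph_def by auto
        then have "h \<otimes> inv g \<in> S"
          using e g assms cayley_graph_adj by auto
        moreover have "e = {g, h \<otimes> inv g \<otimes> g}"
          using g h by (simp add: m_assoc)
        ultimately show "e \<in> ?L" by (rule rev_image_eqI)
      qed
    qed
  qed
  then show "valency (cayley_graph G S) g = card S"
    unfolding valency_def by (rule bij_betw_same_card[symmetric])
qed

end

theory Submission
  imports Defs
begin

text \<open>
  For odd \<open>p = 2h + 1\<close> the rotations and the reflections form two cyclic layers \<open>x\<^sub>i\<close>, \<open>y\<^sub>i\<close>
  with indices modulo \<open>p\<close>: a pair of inverse rotations in \<open>S\<close> contributes the \<open>p\<close>-cycles of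
  difference \<open>2t\<close> in both layers for some \<open>1 \<le> t \<le> h\<close>, and a reflection contributes a matching
  \<open>x\<^sub>i y\<^sub>i\<^sub>+\<^sub>c\<close>. The union of two such matchings is a Hamilton cycle because \<open>p\<close> is prime.
  The two \<open>p\<close>-cycles belonging to \<open>t\<close> are merged into a Hamilton cycle by exchanging the chords
  \<open>x\<^sub>-\<^sub>t x\<^sub>t\<close>, \<open>y\<^sub>-\<^sub>t y\<^sub>t\<close> for the rungs \<open>x\<^sub>-\<^sub>t y\<^sub>-\<^sub>t\<close>, \<open>x\<^sub>t y\<^sub>t\<close> of a fixed matching. These exchanges are
  disjoint for different \<open>t\<close> and turn the fixed matching into another perfect matching. The
  remaining reflections are paired off; if their number is odd, the matching so modified is
  paired with one of them, which, after scaling, is \<open>x\<^sub>i y\<^sub>i\<^sub>+\<^sub>1\<close>.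
\<close>

section \<open>Edge sets of paths and cycles\<close>

text \<open>Paths can be concatenated and reversed without a closing condition; a cycle is later
  handled as a path together with its closing edge.\<close>

fun path_edges :: "'a list \<Rightarrow> 'a set set" where
  "path_edges (a # b # l) = insert {a, b} (path_edges (b # l))"
| "path_edges _ = {}"

lemma path_edges_Cons:
  "l \<noteq> [] \<Longrightarrow> path_edges (a # l) = insert {a, hd l} (path_edges l)"
  by (cases l) auto

lemma path_edges_append:
  "k \<noteq> [] \<Longrightarrow> l \<noteq> [] \<Longrightarrow>
    path_edges (k @ l) = insert {last k, hd l} (path_edges k \<union> path_edges l)"
  by (induction k rule: path_edges.induct) (auto simp: path_edges_Cons)

lemma path_edges_rev [simp]: "path_edges (rev l) = path_edges l"
proof (induction l rule: path_edges.induct)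
  case (1 a b l)
  then show ?case
    using path_edges_append[of "rev (b # l)" "[a]"] by (auto simp: insert_commute)
qed auto

lemma path_edges_conv_nth:
  "path_edges l = {{l ! i, l ! Suc i} | i. Suc i < length l}"
proof (induction l rule: path_edges.induct)
  case (1 a b l)
  have "{{(a # b # l) ! i, (a # b # l) ! Suc i} | i. Suc i < length (a # b # l)} =
      insert {a, b} {{(b # l) ! i, (b # l) ! Suc i} | i. Suc i < length (b # l)}" (is "?L = ?R")
  proof
    show "?L \<subseteq> ?R"
    proof
      fix e assume "e \<in> ?L"
      then obtain i where "e = {(a # b # l) ! i, (a # b # l) ! Suc i}" "Suc i < length (a # b # l)"
        by blast
      then show "e \<in> ?R" by (cases i) auto
    qed
    have "{a, b} \<in> ?L" by (auto intro!: exI[of _ 0])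
    moreover have "{(b # l) ! i, (b # l) ! Suc i} \<in> ?L" if "Suc i < length (b # l)" for i
      using that by (auto intro!: exI[of _ "Suc i"])
    ultimately show "?R \<subseteq> ?L" by blast
  qed
  with 1 show ?case by simp
qed auto

lemma cycle_edges_conv_path_edges:
  assumes "l \<noteq> []"
  shows "cycle_edges l = insert {last l, hd l} (path_edges l)"
proof -
  define n where "n = length l"
  have n: "n > 0" using assms by (simp add: n_def)
  have "cycle_edges l = (\<lambda>i. {l ! i, l ! (Suc i mod n)}) ` {..<n}"
    by (auto simp: cycle_edges_def n_def)
  also have "{..<n} = insert (n - 1) {i. Suc i < n}"
    using n by auto
  also have "(\<lambda>i. {l ! i, l ! (Suc i mod n)}) ` \<dots> = insert {last l, hd l} (path_edges l)"
    using n assms by (auto simp: path_edges_conv_nth n_def last_conv_nth hd_conv_nth)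
  finally show ?thesis .
qed

lemma path_edges_map_upt:
  "path_edges (map f [0..<n]) = {{f i, f (Suc i)} | i. Suc i < n}"
  unfolding path_edges_conv_nth by (intro Collect_cong ex_cong1) auto

text \<open>Since \<open>f n = f 0\<close>, the closing edge is simply the last step of
  \<open>f\<close>, and no index has to be reduced modulo \<open>n\<close>.\<close>

lemma cycle_edges_map_upt:
  assumes "n > 0" "f n = f 0"
  shows "cycle_edges (map f [0..<n]) = {{f i, f (Suc i)} | i. i < n}"
proof -
  have "f (Suc i mod n) = f (Suc i)" if "i < n" for i
    using that assms by (cases "Suc i = n") auto
  with assms(1) show ?thesis
    unfolding cycle_edges_def by (intro Collect_cong ex_cong1) auto
qed


section \<open>Decomposing an edge set into Hamilton cycles\<close>

text \<open>Only the vertex set is kept from \<open>hamilton_cycle\<close>, so that cycles can be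
  found in separate parts of the edge set. That they lie in the graph is recovered from the
  partition.\<close>

definition ham_cycle_on :: "'a set \<Rightarrow> 'a set set \<Rightarrow> bool" where
  "ham_cycle_on V C \<longleftrightarrow>
     (\<exists>vs. distinct vs \<and> length vs \<ge> 3 \<and> set vs = V \<and> C = cycle_edges vs)"

definition ham_decomp_on :: "'a set \<Rightarrow> nat \<Rightarrow> 'a set set \<Rightarrow> bool" where
  "ham_decomp_on V k E \<longleftrightarrow>
     (\<exists>\<C>. finite \<C> \<and> card \<C> = k \<and> (\<forall>C \<in> \<C>. ham_cycle_on V C) \<and> partition_on E \<C>)"

lemma partition_on_Un:
  assumes "partition_on E \<C>" "partition_on F \<D>" "E \<inter> F = {}"
  shows "partition_on (E \<union> F) (\<C> \<union> \<D>)"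
proof (rule partition_onI)
  have C: "\<Union>\<C> = E" "disjoint \<C>" and D: "\<Union>\<D> = F" "disjoint \<D>"
    using assms(1,2) by (simp_all add: partition_on_def)
  fix A B assume AB: "A \<in> \<C> \<union> \<D>" "B \<in> \<C> \<union> \<D>" "A \<noteq> B"
  have "A \<inter> B = {}" if "A \<in> \<C>" "B \<in> \<D>" for A B
    using that C(1) D(1) assms(3) by blast
  with AB C(2) D(2) show "disjnt A B"
    unfolding disjnt_def disjoint_def by (metis Int_commute Un_iff)
qed (use assms in \<open>auto simp: partition_on_def\<close>)

text \<open>Distinctness comes from counting: a list that covers \<open>V\<close> and has length
  \<open>card V\<close> cannot repeat an entry. Later proofs therefore only show that their lists
  reach every vertex.\<close>

lemma ham_cycle_onI:
  assumes "set vs = V" "length vs = card V" "card V \<ge> 3"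
  shows "ham_cycle_on V (cycle_edges vs)"
  unfolding ham_cycle_on_def using assms by (metis card_distinct)

lemma ham_cycle_on_nonempty: "ham_cycle_on V C \<Longrightarrow> C \<noteq> {}"
  unfolding ham_cycle_on_def
  by (metis cycle_edges_conv_path_edges insert_not_empty list.size(3) not_numeral_le_zero)

lemma ham_decomp_on_empty: "ham_decomp_on V 0 {}"
  unfolding ham_decomp_on_def by (rule exI[of _ "{}"]) (auto simp: partition_on_def)

lemma ham_decomp_on_single:
  assumes "ham_cycle_on V C"
  shows "ham_decomp_on V (Suc 0) C"
  unfolding ham_decomp_on_def using assms ham_cycle_on_nonempty[OF assms]
  by (intro exI[of _ "{C}"]) (auto simp: partition_on_def disjoint_def)

lemma ham_decomp_on_Un:
  assumes "ham_decomp_on V j E" "ham_decomp_on V k F" "E \<inter> F = {}"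
  shows "ham_decomp_on V (j + k) (E \<union> F)"
proof -
  obtain \<C> where C: "finite \<C>" "card \<C> = j" "\<forall>C \<in> \<C>. ham_cycle_on V C" "partition_on E \<C>"
    using assms(1) unfolding ham_decomp_on_def by blast
  obtain \<D> where D: "finite \<D>" "card \<D> = k" "\<forall>C \<in> \<D>. ham_cycle_on V C" "partition_on F \<D>"
    using assms(2) unfolding ham_decomp_on_def by blast
  have "partition_on (E \<union> F) (\<C> \<union> \<D>)"
    using C(4) D(4) assms(3) by (rule partition_on_Un)
  \<comment> \<open>A common block would lie in both \<open>E\<close> and \<open>F\<close> and so be
    empty, but a partition has no empty block. Hence the numbers of cycles add up.\<close>
  moreover have "A = {}" if "A \<in> \<C>" "A \<in> \<D>" for A
    using that assms(3) partition_onD1[OF C(4)] partition_onD1[OF D(4)] by blast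
  then have "\<C> \<inter> \<D> = {}"
    using partition_onD3[OF C(4)] by blast
  then have "card (\<C> \<union> \<D>) = j + k"
    using C D by (simp add: card_Un_disjoint)
  ultimately show ?thesis
    unfolding ham_decomp_on_def using C D by (intro exI[of _ "\<C> \<union> \<D>"]) auto
qed

lemma ham_decomp_on_UN:
  assumes "finite I" "\<And>i. i \<in> I \<Longrightarrow> ham_cycle_on V (F i)"
    and "\<And>i j. i \<in> I \<Longrightarrow> j \<in> I \<Longrightarrow> i \<noteq> j \<Longrightarrow> F i \<inter> F j = {}"
  shows "ham_decomp_on V (card I) (\<Union>i\<in>I. F i)"
  using assms
proof (induction I rule: finite_induct)
  case empty
  then show ?case by (simp add: ham_decomp_on_empty)
next
  case (insert i I)
  have "F i \<inter> (\<Union>i\<in>I. F i) = {}"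
    using insert.prems(2)[of i] insert.hyps by blast
  with insert have "ham_decomp_on V (Suc 0 + card I) (F i \<union> (\<Union>i\<in>I. F i))"
    by (intro ham_decomp_on_Un ham_decomp_on_single) auto
  with insert.hyps show ?case by simp
qed

text \<open>Any two of the sets form a Hamilton cycle, so the pairing is arbitrary and the induction
  removes two indices at a time.\<close>

lemma ham_decomp_on_UN_pairs:
  assumes "finite I" "even (card I)"
    and "\<And>i j. i \<in> I \<Longrightarrow> j \<in> I \<Longrightarrow> i \<noteq> j \<Longrightarrow> ham_cycle_on V (F i \<union> F j)"
    and "\<And>i j. i \<in> I \<Longrightarrow> j \<in> I \<Longrightarrow> i \<noteq> j \<Longrightarrow> F i \<inter> F j = {}"
  shows "ham_decomp_on V (card I div 2) (\<Union>i\<in>I. F i)"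
  using assms
proof (induction "card I" arbitrary: I rule: less_induct)
  case less
  show ?case
  proof (cases "I = {}")
    case True
    then show ?thesis by (simp add: ham_decomp_on_empty)
  next
    case False
    then obtain i where i: "i \<in> I" by blast
    have "card I > 0" using False less.prems(1) by (simp add: card_gt_0_iff)
    with less.prems(2) have c2: "card I \<ge> 2" by (auto elim: evenE)
    then have "card (I - {i}) > 0" using i less.prems(1) by simp
    then obtain j where j: "j \<in> I" "j \<noteq> i"
      using less.prems(1) by (metis Diff_iff all_not_in_conv card_gt_0_iff singletonI)
    define J where "J = I - {i, j}"
    have I: "I = insert i (insert j J)" using i j by (auto simp: J_def)
    have J: "finite J" "i \<notin> J" "j \<notin> J" using less.prems(1) by (auto simp: J_def)
    have cI: "card I = card J + 2" using J j by (simp add: I)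
    have "ham_decomp_on V (card J div 2) (\<Union>i\<in>J. F i)"
      using less.prems J cI by (intro less.hyps) (auto simp: I)
    moreover have "ham_decomp_on V (Suc 0) (F i \<union> F j)"
      using less.prems(3) i j by (intro ham_decomp_on_single) auto
    moreover have "(F i \<union> F j) \<inter> (\<Union>i\<in>J. F i) = {}"
      using less.prems(4)[of i] less.prems(4)[of j] i j J I by blast
    ultimately have "ham_decomp_on V (Suc 0 + card J div 2) ((F i \<union> F j) \<union> (\<Union>i\<in>J. F i))"
      by (intro ham_decomp_on_Un)
    with cI show ?thesis by (simp add: I Un_assoc)
  qed
qed

lemma hamilton_decomposition_evenI:
  assumes "regular_graph \<Gamma> (2 * k)" "k \<ge> 1" "ham_decomp_on (verts \<Gamma>) k (edges \<Gamma>)"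
  shows "hamilton_decomposition \<Gamma>"
proof -
  obtain \<C> where C: "finite \<C>" "card \<C> = k" "\<forall>C \<in> \<C>. ham_cycle_on (verts \<Gamma>) C"
      "partition_on (edges \<Gamma>) \<C>"
    using assms(3) unfolding ham_decomp_on_def by blast
  then have "\<forall>C \<in> \<C>. hamilton_cycle \<Gamma> C"
    unfolding ham_cycle_on_def hamilton_cycle_def partition_on_def by blast
  with C assms(1,2) show ?thesis unfolding hamilton_decomposition_def by blast
qed

lemma hamilton_decomposition_oddI:
  assumes "regular_graph \<Gamma> (2 * k + 1)" "perfect_matching \<Gamma> M" "verts \<Gamma> \<noteq> {}"
    and "ham_decomp_on (verts \<Gamma>) k (edges \<Gamma> - M)"
  shows "hamilton_decomposition \<Gamma>"
proof -
  obtain \<C> where C: "finite \<C>" "card \<C> = k" "\<forall>C \<in> \<C>. ham_cycle_on (verts \<Gamma>) C"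
      "partition_on (edges \<Gamma> - M) \<C>"
    using assms(4) unfolding ham_decomp_on_def by blast
  \<comment> \<open>Some vertex exists and is covered by \<open>M\<close>. Being nonempty,
    \<open>M\<close> can serve as a block and differs from every block inside its
    complement.\<close>
  have M: "M \<subseteq> edges \<Gamma>" "M \<noteq> {}"
    using assms(2,3) unfolding perfect_matching_def by auto
  have "\<forall>C \<in> \<C>. hamilton_cycle \<Gamma> C"
    using C unfolding ham_cycle_on_def hamilton_cycle_def partition_on_def by blast
  moreover have "M \<notin> \<C>"
    using C(4) M unfolding partition_on_def by blast
  moreover have "partition_on (edges \<Gamma>) (insert M \<C>)"
  proof -
    have "partition_on (M \<union> (edges \<Gamma> - M)) ({M} \<union> \<C>)"
      using C(4) M(2) by (intro partition_on_Un) (auto simp: partition_on_def disjoint_def)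
    moreover have "M \<union> (edges \<Gamma> - M) = edges \<Gamma>" using M(1) by blast
    ultimately show ?thesis by simp
  qed
  ultimately show ?thesis
    unfolding hamilton_decomposition_def using C(1,2) assms(1,2)
    \<comment> \<open>The definition writes an odd valency as \<open>2 * k - 1\<close>, so its
      parameter exceeds the number of cycles by one.\<close>
    by (intro exI[of _ "Suc k"]) auto
qed


section \<open>Two cyclic layers joined by matchings\<close>

text \<open>Indices are integers, not residues: equality of vertices becomes divisibility by
  \<open>p\<close>, and negative indices express the symmetry about 0. No group is involved until
  the interpretation.\<close>

locale two_layers =
  fixes p h :: int and x y :: "int \<Rightarrow> 'a"
  assumes prime: "Factorial_Ring.prime p" and p: "p = 2 * h + 1"
    and x_eq: "x i = x j \<longleftrightarrow> p dvd i - j"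
    and y_eq: "y i = y j \<longleftrightarrow> p dvd i - j"
    and x_neq_y: "x i \<noteq> y j"
begin

section \<open>Residues modulo \<open>p\<close>\<close>

lemma y_neq_x: "y i \<noteq> x j"
  using x_neq_y by metis

lemma h_pos: "h \<ge> 1"
  using prime_ge_2_int[OF prime] p by linarith

lemma not_dvd_2: "\<not> p dvd 2"
  using zdvd_imp_le[of p 2] h_pos p by auto

lemma dvd_2_mult: "p dvd 2 * i \<longleftrightarrow> p dvd i"
  using prime_dvd_mult_iff[OF prime, of 2 i] not_dvd_2 by blast

text \<open>The integers from \<open>-h\<close> to \<open>h\<close> are pairwise incongruent,
  because their differences are at most \<open>2 * h < p\<close> in absolute value.\<close>

lemma dvd_diff_small:
  assumes "p dvd i - j" "\<bar>i\<bar> \<le> h" "\<bar>j\<bar> \<le> h"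
  shows "i = j"
proof (rule ccontr)
  assume "i \<noteq> j"
  then have "\<bar>p\<bar> \<le> \<bar>i - j\<bar>" using assms(1) by (intro dvd_imp_le_int) auto
  with assms(2,3) p h_pos show False by linarith
qed

lemma not_dvd_small: "t \<in> {1..h} \<Longrightarrow> \<not> p dvd t"
  using dvd_diff_small[of t 0] by auto

lemma ex_small:
  obtains j where "\<bar>j\<bar> \<le> h" "p dvd i - j"
proof
  \<comment> \<open>Shifting by \<open>h\<close> before the reduction and back afterwards yields the
    representative between \<open>-h\<close> and \<open>h\<close>.\<close>
  have "0 \<le> (i + h) mod p" "(i + h) mod p < p" using p h_pos by (simp_all only: pos_mod_bound pos_mod_sign)
  then show "\<bar>(i + h) mod p - h\<bar> \<le> h" using p by linarith
  have "i - ((i + h) mod p - h) = p * ((i + h) div p)"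
    by (simp add: minus_mod_eq_mult_div[symmetric])
  then show "p dvd i - ((i + h) mod p - h)" by simp
qed

text \<open>As \<open>p\<close> is prime, \<open>e\<close> is invertible modulo \<open>p\<close>, so
  the progression with first term \<open>c\<close> and difference \<open>e\<close> meets every
  residue class within \<open>p\<close> terms. This is why the walks below reach all
  vertices.\<close>

lemma ex_multiple:
  assumes "\<not> p dvd e"
  obtains k where "k < nat p" "p dvd i - (int k * e + c)"
proof -
  have "coprime e p"
    using prime_imp_coprime[OF prime assms] by (simp add: coprime_commute)
  then obtain a b where ab: "a * e + b * p = 1"
    using bezout_int[of e p] by auto
  \<comment> \<open>By Bezout, \<open>a\<close> is an inverse of \<open>e\<close> modulo
    \<open>p\<close>; the reduced solution \<open>r\<close> is the wanted multiplier.\<close>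
  define q r where "q = (i - c) * a div p" and "r = (i - c) * a mod p"
  have qr: "(i - c) * a = p * q + r" by (simp add: q_def r_def)
  have "(i - c) * a * e + (i - c) * b * p = i - c"
    using arg_cong[OF ab, of "\<lambda>z. (i - c) * z"] by (simp add: algebra_simps)
  then have "(p * q + r) * e + (i - c) * b * p = i - c" unfolding qr .
  then have "i - (r * e + c) = p * ((i - c) * b + e * q)"
    by (simp add: algebra_simps)
  moreover have "0 \<le> r" "r < p" using p h_pos by (simp_all only: r_def pos_mod_bound pos_mod_sign)
  ultimately show ?thesis
    using that[of "nat r"] by simp
qed

section \<open>Vertices, rungs and layers\<close>

definition V :: "'a set" where "V = range x \<union> range y"

lemma range_periodic:
  fixes z :: "int \<Rightarrow> 'a"
  assumes "\<And>i j. z i = z j \<longleftrightarrow> p dvd i - j"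
  shows "range z = z ` {-h..h}" "card (range z) = nat p"
proof -
  have "z i \<in> z ` {-h..h}" for i
    using ex_small[of i] assms by (metis abs_le_iff atLeastAtMost_iff image_eqI minus_le_iff)
  then show *: "range z = z ` {-h..h}" by auto
  have "inj_on z {-h..h}"
    using dvd_diff_small by (auto simp: inj_on_def assms)
  then show "card (range z) = nat p"
    unfolding * using p by (simp add: card_image)
qed

lemma card_V: "card V = 2 * nat p"
proof -
  note ranges = range_periodic[of x, OF x_eq] range_periodic[of y, OF y_eq]
  have "finite (range x)" "finite (range y)" unfolding ranges(1,3) by simp_all
  moreover have "range x \<inter> range y = {}" using x_neq_y by blast
  ultimately show ?thesis
    using ranges(2,4) by (simp add: V_def card_Un_disjoint)
qed

lemma card_V_ge: "card V \<ge> 3"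
  using card_V p h_pos by simp

definition rung :: "int \<Rightarrow> 'a set set" where
  "rung c = range (\<lambda>i. {x i, y (i + c)})"

definition layers :: "int \<Rightarrow> 'a set set" where
  "layers d = range (\<lambda>i. {x i, x (i + d)}) \<union> range (\<lambda>i. {y i, y (i + d)})"

lemma rung_disjoint:
  assumes "\<not> p dvd c - d"
  shows "rung c \<inter> rung d = {}"
proof -
  have False if "p dvd i - j" "p dvd i + c - (j + d)" for i j
  proof -
    have "p dvd (i + c - (j + d)) - (i - j)" by (rule dvd_diff[OF that(2,1)])
    with assms show False by (simp add: algebra_simps)
  qed
  then show ?thesis
    by (auto simp: rung_def doubleton_eq_iff x_eq y_eq x_neq_y y_neq_x)
qed

lemma layers_rung_disjoint: "layers d \<inter> rung c = {}"
  by (auto simp: rung_def layers_def doubleton_eq_iff x_neq_y y_neq_x)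

text \<open>A common edge, read in equal or in opposite directions, gives \<open>2 * s\<close>
  congruent to \<open>2 * t\<close> or to \<open>- 2 * t\<close>. Halving modulo \<open>p\<close>
  leaves \<open>s\<close> congruent to \<open>t\<close> or \<open>- t\<close>, impossible for
  distinct elements of \<open>{1..h}\<close>.\<close>

lemma layers_disjoint:
  assumes "s \<in> {1..h}" "t \<in> {1..h}" "s \<noteq> t"
  shows "layers (2 * s) \<inter> layers (2 * t) = {}"
proof -
  have 1: False if "p dvd i - j" "p dvd i + 2 * s - (j + 2 * t)" for i j
  proof -
    have "p dvd (i + 2 * s - (j + 2 * t)) - (i - j)" by (rule dvd_diff[OF that(2,1)])
    then have "p dvd s - t" using dvd_2_mult[of "s - t"] by (simp add: algebra_simps)
    with dvd_diff_small[of s t] assms show False by auto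
  qed
  have 2: False if "p dvd i - (j + 2 * t)" "p dvd i + 2 * s - j" for i j
  proof -
    have "p dvd (i + 2 * s - j) - (i - (j + 2 * t))" by (rule dvd_diff[OF that(2,1)])
    then have "p dvd s - (- t)" using dvd_2_mult[of "s + t"] by (simp add: algebra_simps)
    with dvd_diff_small[of s "- t"] assms show False by auto
  qed
  show ?thesis
    using 1 2 by (auto simp: layers_def doubleton_eq_iff x_eq y_eq x_neq_y y_neq_x)
qed

text \<open>Going up along \<open>rung c\<close> and back along \<open>rung d\<close> adds
  \<open>c - d\<close> to the index in \<open>x\<close>. This difference generates all residues, so
  the alternating walk closes only after all \<open>2 * p\<close> vertices.\<close>

lemma ham_cycle_rungs:
  assumes "\<not> p dvd c - d"
  shows "ham_cycle_on V (rung c \<union> rung d)"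
proof -
  define e where "e = c - d"
  \<comment> \<open>Even positions of the walk lie in layer \<open>x\<close>, odd ones in layer
    \<open>y\<close>.\<close>
  define f where "f k = (if even k then x (int (k div 2) * e) else y (int (k div 2) * e + c))"
    for k :: nat
  have f_simps: "f (2 * k) = x (int k * e)" "f (Suc (2 * k)) = y (int k * e + c)"
    "f (Suc (Suc (2 * k))) = x (int k * e + e)" for k
    by (simp_all add: f_def algebra_simps)
  define n where "n = 2 * nat p"
  have edges: "cycle_edges (map f [0..<n]) = rung c \<union> rung d"
  proof -
    have "f n = f 0" using p h_pos by (simp add: f_def n_def x_eq)
    moreover have "n > 0" using p h_pos by (simp add: n_def)
    ultimately have "cycle_edges (map f [0..<n]) = {{f i, f (Suc i)} | i. i < n}"
      by (intro cycle_edges_map_upt)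
    also have "\<dots> = rung c \<union> rung d"
    proof
      show "{{f i, f (Suc i)} | i. i < n} \<subseteq> rung c \<union> rung d"
      proof clarify
        fix i assume "{f i, f (Suc i)} \<notin> rung d"
        show "{f i, f (Suc i)} \<in> rung c"
        proof (cases "even i")
          case True
          then obtain k where "i = 2 * k" by blast
          then show ?thesis by (auto simp: f_simps rung_def)
        next
          case False
          then obtain k where "i = Suc (2 * k)" by (metis oddE Suc_eq_plus1)
          \<comment> \<open>Because \<open>c = e + d\<close>, the way back from \<open>y\<close> to
            the next \<open>x\<close> is an edge of \<open>rung d\<close>.\<close>
          then have "{f i, f (Suc i)} = {x (int k * e + e), y (int k * e + e + d)}"
            by (simp add: f_simps insert_commute e_def)
          then have "{f i, f (Suc i)} \<in> rung d" unfolding rung_def by blast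
          with \<open>{f i, f (Suc i)} \<notin> rung d\<close> show ?thesis by blast
        qed
      qed
      show "rung c \<union> rung d \<subseteq> {{f i, f (Suc i)} | i. i < n}"
      proof
        fix E assume "E \<in> rung c \<union> rung d"
        then consider i where "E = {x i, y (i + c)}" | i where "E = {x i, y (i + d)}"
          by (auto simp: rung_def)
        then show "E \<in> {{f i, f (Suc i)} | i. i < n}"
        proof cases
          case 1
          obtain k where k: "k < nat p" "p dvd i - (int k * e + 0)"
            using ex_multiple assms e_def by metis
          then have "E = {f (2 * k), f (Suc (2 * k))}"
            using 1 by (simp add: f_simps doubleton_eq_iff x_eq y_eq)
          then show ?thesis using k(1) unfolding n_def by fastforce
        next
          case 2
          obtain k where k: "k < nat p" "p dvd i - (int k * e + e)"
            using ex_multiple assms e_def by metis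
          have "i + d - (int k * e + c) = i - (int k * e + e)" by (simp add: e_def)
          then have "p dvd i + d - (int k * e + c)" using k(2) by metis
          then have "E = {f (Suc (2 * k)), f (Suc (Suc (2 * k)))}"
            using 2 k by (simp add: f_simps doubleton_eq_iff x_eq y_eq)
          then show ?thesis using k(1) unfolding n_def by fastforce
        qed
      qed
    qed
    finally show ?thesis .
  qed
  have "set (map f [0..<n]) = V"
  proof
    show "set (map f [0..<n]) \<subseteq> V" by (auto simp: f_def V_def)
    show "V \<subseteq> set (map f [0..<n])"
    proof
      fix v assume "v \<in> V"
      then consider i where "v = x i" | i where "v = y i" by (auto simp: V_def)
      then show "v \<in> set (map f [0..<n])"
      proof cases
        case 1
        obtain k where k: "k < nat p" "p dvd i - (int k * e + 0)"
          using ex_multiple assms e_def by metis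
        then have "v = f (2 * k)" using 1 by (simp add: f_simps x_eq)
        then show ?thesis using k(1) by (auto simp: n_def)
      next
        case 2
        obtain k where k: "k < nat p" "p dvd i - (int k * e + c)"
          using ex_multiple assms e_def by metis
        then have "v = f (Suc (2 * k))" using 2 by (simp add: f_simps y_eq)
        then show ?thesis using k(1) by (auto simp: n_def)
      qed
    qed
  qed
  then have "ham_cycle_on V (cycle_edges (map f [0..<n]))"
    using card_V card_V_ge by (intro ham_cycle_onI) (auto simp: n_def)
  then show ?thesis by (simp add: edges)
qed

section \<open>Merging the two cycles of one difference\<close>

text \<open>The walk \<open>t\<close>, \<open>3 * t\<close>, \<open>5 * t\<close>, ... ends after
  \<open>p\<close> vertices at a multiple congruent to \<open>- t\<close>. It is the cycle of
  difference \<open>2 * t\<close> with exactly the chord between \<open>- t\<close> and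
  \<open>t\<close> cut out. The sequence \<open>z\<close> stands for either layer.\<close>

lemma layer_path:
  fixes z :: "int \<Rightarrow> 'a"
  assumes z: "\<And>i j. z i = z j \<longleftrightarrow> p dvd i - j" and t: "\<not> p dvd t"
  defines "l \<equiv> map (\<lambda>k. z ((2 * int k + 1) * t)) [0..<nat p]"
  shows "path_edges l = range (\<lambda>i. {z i, z (i + 2 * t)}) - {{z (- t), z t}}"
    and "set l = range z" and "hd l = z t" and "last l = z (- t)"
    and "l \<noteq> []" and "length l = nat p"
proof -
  have t2: "\<not> p dvd 2 * t" using t dvd_2_mult by blast
  have ppos: "nat p > 0" using p h_pos by simp
  show "length l = nat p" and "l \<noteq> []" using ppos by (simp_all add: l_def)
  show "hd l = z t" using ppos by (simp add: l_def hd_map)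
  have "(2 * int (nat p - 1) + 1) * t - (- t) = p * (2 * t)"
    using ppos by (simp add: of_nat_diff algebra_simps)
  then have "z ((2 * int (nat p - 1) + 1) * t) = z (- t)"
    unfolding z by (metis dvd_triv_left)
  then show "last l = z (- t)" using ppos by (simp add: l_def last_map)
  have z_ex: "\<exists>k<nat p. z i = z ((2 * int k + 1) * t)" for i
  proof -
    obtain k where "k < nat p" "p dvd i - (int k * (2 * t) + t)"
      using ex_multiple[OF t2] by blast
    moreover have "int k * (2 * t) + t = (2 * int k + 1) * t" by (simp add: algebra_simps)
    ultimately show ?thesis unfolding z by metis
  qed
  then show "set l = range z" unfolding l_def by fastforce
  let ?g = "\<lambda>k. z ((2 * int k + 1) * t)"
  have step: "?g (Suc k) = z ((2 * int k + 1) * t + 2 * t)" for k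
    by (simp add: algebra_simps)
  have "path_edges l = {{?g k, ?g (Suc k)} | k. Suc k < nat p}"
    unfolding l_def by (rule path_edges_map_upt)
  also have "\<dots> = range (\<lambda>i. {z i, z (i + 2 * t)}) - {{z (- t), z t}}"
  proof
    show "{{?g k, ?g (Suc k)} | k. Suc k < nat p} \<subseteq> range (\<lambda>i. {z i, z (i + 2 * t)}) - {{z (- t), z t}}"
    proof clarify
      fix k assume k: "Suc k < nat p"
      \<comment> \<open>A path edge might equal the chord in either direction. To start at
        \<open>- t\<close>, \<open>p\<close> would have to divide \<open>k + 1\<close>, which is
        positive and less than \<open>p\<close>.\<close>
      have False if "?g k = z (- t)"
      proof -
        have "(2 * int k + 1) * t - (- t) = 2 * (int (Suc k) * t)" by (simp add: algebra_simps)
        with that have "p dvd int (Suc k) * t" unfolding z using dvd_2_mult by metis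
        then have "p dvd int (Suc k)" using prime_dvd_mult_iff[OF prime] t by blast
        then have "p \<le> int (Suc k)" by (intro zdvd_imp_le) auto
        with k show False by linarith
      qed
      \<comment> \<open>In the other direction \<open>p\<close> would divide both
        \<open>k * t\<close> and \<open>k * t + 2 * t\<close>, hence \<open>2 * t\<close>.\<close>
      moreover have False if "?g k = z t" "?g (Suc k) = z (- t)"
      proof -
        have "(2 * int k + 1) * t - t = 2 * (int k * t)" by (simp add: algebra_simps)
        with that(1) have 1: "p dvd int k * t" unfolding z using dvd_2_mult by metis
        have "(2 * int (Suc k) + 1) * t - (- t) = 2 * (int k * t + 2 * t)" by (simp add: algebra_simps)
        with that(2) have "p dvd int k * t + 2 * t" unfolding z using dvd_2_mult by metis
        with 1 t2 show False using dvd_add_right_iff by blast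
      qed
      ultimately show "{?g k, ?g (Suc k)} \<in> range (\<lambda>i. {z i, z (i + 2 * t)}) - {{z (- t), z t}}"
        using step by (auto simp: doubleton_eq_iff)
    qed
    show "range (\<lambda>i. {z i, z (i + 2 * t)}) - {{z (- t), z t}} \<subseteq> {{?g k, ?g (Suc k)} | k. Suc k < nat p}"
    proof clarify
      fix i assume neq: "{z i, z (i + 2 * t)} \<noteq> {z (- t), z t}"
      obtain k where k: "k < nat p" "z i = ?g k" using z_ex by blast
      then have eq: "z (i + 2 * t) = ?g (Suc k)" unfolding step by (simp add: z)
      have "Suc k < nat p"
      proof (rule ccontr)
        \<comment> \<open>Only the last vertex has no successor on the path, and the edge leaving it
          is the excluded chord.\<close>
        assume "\<not> Suc k < nat p"
        then have "k = nat p - 1" using k by simp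
        then have "z i = z (- t)"
          using k \<open>z ((2 * int (nat p - 1) + 1) * t) = z (- t)\<close> by simp
        moreover from this have "z (i + 2 * t) = z t" by (simp add: z algebra_simps)
        ultimately show False using neq by simp
      qed
      with k(2) eq show "\<exists>k. {z i, z (i + 2 * t)} = {?g k, ?g (Suc k)} \<and> Suc k < nat p"
        by metis
    qed
  qed
  finally show "path_edges l = range (\<lambda>i. {z i, z (i + 2 * t)}) - {{z (- t), z t}}" .
qed

text \<open>Differences are written as \<open>2 * t\<close> so that each layer cycle has an edge
  symmetric about 0. As 2 is invertible modulo \<open>p\<close>, the values \<open>t\<close> in
  \<open>{1..h}\<close> give all nonzero differences up to sign.\<close>

definition chords :: "int \<Rightarrow> 'a set set" where
  "chords t = {{x (- t), x t}, {y (- t), y t}}"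

definition links :: "int \<Rightarrow> 'a set set" where
  "links t = {{x (- t), y (- t)}, {x t, y t}}"

lemma chords_subset: "chords t \<subseteq> layers (2 * t)"
proof -
  have "{x (- t), x t} = {x (- t), x (- t + 2 * t)}" "{y (- t), y t} = {y (- t), y (- t + 2 * t)}"
    by simp_all
  then show ?thesis unfolding chords_def layers_def by blast
qed

lemma links_subset: "links t \<subseteq> rung 0"
  unfolding links_def rung_def by auto

text \<open>Both layer paths run from index \<open>t\<close> to index \<open>- t\<close>. Following
  the first by the reverse of the second needs just the two edges in \<open>links t\<close> to close
  up.\<close>

lemma ham_cycle_switched:
  assumes "\<not> p dvd t"
  shows "ham_cycle_on V ((layers (2 * t) - chords t) \<union> links t)"
proof -
  define k where "k = map (\<lambda>k. x ((2 * int k + 1) * t)) [0..<nat p]"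
  define l where "l = map (\<lambda>k. y ((2 * int k + 1) * t)) [0..<nat p]"
  note X = layer_path[of x, OF x_eq assms, folded k_def]
  note Y = layer_path[of y, OF y_eq assms, folded l_def]
  have "cycle_edges (k @ rev l) = links t \<union> (path_edges k \<union> path_edges l)"
    using X(3-5) Y(3-5)
    by (simp add: cycle_edges_conv_path_edges path_edges_append hd_rev last_rev links_def
        insert_commute)
  \<comment> \<open>Neither removed chord occurs in the other layer, so both can be subtracted from
    the union at once.\<close>
  moreover have "{x (- t), x t} \<notin> range (\<lambda>i. {y i, y (i + 2 * t)})"
    "{y (- t), y t} \<notin> range (\<lambda>i. {x i, x (i + 2 * t)})"
    by (auto simp: doubleton_eq_iff x_neq_y y_neq_x)
  then have "path_edges k \<union> path_edges l = layers (2 * t) - chords t"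
    unfolding X(1) Y(1) layers_def chords_def by blast
  ultimately have "cycle_edges (k @ rev l) = (layers (2 * t) - chords t) \<union> links t"
    by blast
  moreover have "ham_cycle_on V (cycle_edges (k @ rev l))"
    using X Y card_V card_V_ge by (intro ham_cycle_onI) (auto simp: V_def)
  ultimately show ?thesis by simp
qed

section \<open>The modified perfect matching\<close>

text \<open>This is \<open>rung 0\<close> after trading \<open>links t\<close> for
  \<open>chords t\<close> at every \<open>t\<close> in \<open>T\<close>. Restricting to
  \<open>\<bar>i\<bar> \<le> h\<close> lists each rung once and lets the absolute value name the
  pair of rungs at \<open>i\<close> and \<open>- i\<close>.\<close>

definition switched_rung :: "int set \<Rightarrow> 'a set set" where
  "switched_rung T = {{x i, y i} | i. \<bar>i\<bar> \<le> h \<and> \<bar>i\<bar> \<notin> T} \<union> (\<Union>t\<in>T. chords t)"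

lemma rung_small: "rung 0 = {{x i, y i} | i. \<bar>i\<bar> \<le> h}"
proof
  show "rung 0 \<subseteq> {{x i, y i} | i. \<bar>i\<bar> \<le> h}"
  proof
    fix e assume "e \<in> rung 0"
    then obtain i where e: "e = {x i, y i}" by (auto simp: rung_def)
    obtain j where "\<bar>j\<bar> \<le> h" "p dvd i - j" using ex_small .
    moreover from this have "e = {x j, y j}" using e x_eq[of i j] y_eq[of i j] by simp
    ultimately show "e \<in> {{x i, y i} | i. \<bar>i\<bar> \<le> h}" by blast
  qed
qed (auto simp: rung_def)

lemma x_small: "\<bar>i\<bar> \<le> h \<Longrightarrow> \<bar>j\<bar> \<le> h \<Longrightarrow> x i = x j \<longleftrightarrow> i = j"
  and y_small: "\<bar>i\<bar> \<le> h \<Longrightarrow> \<bar>j\<bar> \<le> h \<Longrightarrow> y i = y j \<longleftrightarrow> i = j"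
  using dvd_diff_small by (auto simp: x_eq y_eq)

lemma links_disjoint:
  assumes "s \<in> {1..h}" "t \<in> {1..h}" "s \<noteq> t"
  shows "links s \<inter> links t = {}"
  using assms by (auto simp: links_def doubleton_eq_iff x_neq_y y_neq_x x_small y_small)

lemma switched_disjoint:
  assumes "s \<in> {1..h}" "t \<in> {1..h}" "s \<noteq> t"
  shows "((layers (2 * s) - chords s) \<union> links s) \<inter> ((layers (2 * t) - chords t) \<union> links t) = {}"
  using links_disjoint[OF assms] layers_disjoint[OF assms] links_subset[of s] links_subset[of t]
    layers_rung_disjoint[of "2 * s" 0] layers_rung_disjoint[of "2 * t" 0] by blast

lemma switched_rung_disjoint:
  assumes T: "T \<subseteq> {1..h}" and t: "t \<in> T"
  shows "((layers (2 * t) - chords t) \<union> links t) \<inter> switched_rung T = {}"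
proof -
  have "{x i, y i} \<notin> links t" if "\<bar>i\<bar> \<le> h" "\<bar>i\<bar> \<notin> T" for i
    using that T t by (auto simp: links_def doubleton_eq_iff x_neq_y y_neq_x x_small)
  then have 1: "links t \<inter> {{x i, y i} | i. \<bar>i\<bar> \<le> h \<and> \<bar>i\<bar> \<notin> T} = {}" by blast
  have 2: "(layers (2 * t) - chords t) \<inter> {{x i, y i} | i. \<bar>i\<bar> \<le> h \<and> \<bar>i\<bar> \<notin> T} = {}"
    using layers_rung_disjoint[of "2 * t" 0] unfolding rung_small by blast
  have 3: "(layers (2 * t) - chords t) \<inter> chords s = {}" if "s \<in> T" for s
  proof (cases "s = t")
    case False
    moreover have "s \<in> {1..h}" "t \<in> {1..h}" using that T t by auto
    ultimately show ?thesis using layers_disjoint[of t s] chords_subset[of s] by blast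
  qed auto
  have 4: "links t \<inter> chords s = {}" for s
    using links_subset[of t] chords_subset[of s] layers_rung_disjoint[of "2 * s" 0] by blast
  show ?thesis
    by (simp add: switched_rung_def Int_Un_distrib Int_Un_distrib2 Int_UN_distrib 1 2 3 4)
qed

text \<open>Switching only redistributes edges: the chords pass from the layers to the matching and
  the links pass the other way.\<close>

lemma switched_union:
  assumes "T \<subseteq> {1..h}"
  shows "(\<Union>t\<in>T. (layers (2 * t) - chords t) \<union> links t) \<union> switched_rung T =
    (\<Union>t\<in>T. layers (2 * t)) \<union> rung 0" (is "?L = ?R")
proof
  show "?L \<subseteq> ?R"
    using chords_subset links_subset unfolding switched_rung_def rung_small by blast
  have "{x i, y i} \<in> ?L" if "\<bar>i\<bar> \<le> h" for i
  proof (cases "\<bar>i\<bar> \<in> T")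
    case True
    have "{x i, y i} \<in> links \<bar>i\<bar>" by (cases "i \<ge> 0") (auto simp: links_def)
    with True show ?thesis by blast
  qed (use that in \<open>auto simp: switched_rung_def\<close>)
  then show "?R \<subseteq> ?L"
    unfolding rung_small by (auto simp: switched_rung_def)
qed

text \<open>If the absolute value of the index lies in \<open>T\<close>, the vertex is matched
  within its layer to the vertex of opposite index. Otherwise it keeps its rung.\<close>

lemma switched_rung_matching:
  assumes T: "T \<subseteq> {1..h}" and v: "v \<in> V"
  shows "\<exists>!e. e \<in> switched_rung T \<and> v \<in> e"
proof -
  obtain i where i: "\<bar>i\<bar> \<le> h" "v = x i \<or> v = y i"
    using v ex_small unfolding V_def by (metis UnE imageE x_eq y_eq)
  \<comment> \<open>A chord through \<open>v\<close> must carry the label given by the index of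
    \<open>v\<close>, and the layer of \<open>v\<close> decides which of the two chords it
    is.\<close>
  have chord: "\<bar>i\<bar> = t \<and> e = (if v = x i then {x (- t), x t} else {y (- t), y t})"
    if "t \<in> T" "e \<in> chords t" "v \<in> e" for t e
  proof -
    have t: "\<bar>t\<bar> \<le> h" "\<bar>- t\<bar> \<le> h" "t > 0" using that(1) T by auto
    from that(2) consider "e = {x (- t), x t}" | "e = {y (- t), y t}"
      by (auto simp: chords_def)
    then show ?thesis
    proof cases
      case 1
      then have "v = x i" using i(2) that(3) x_neq_y by blast
      then have "x i = x (- t) \<or> x i = x t" using 1 that(3) by blast
      then have "i = - t \<or> i = t" using x_small[OF i(1)] t by blast
      then show ?thesis using 1 \<open>v = x i\<close> t by auto
    next
      case 2
      then have "v = y i" using i(2) that(3) y_neq_x by blast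
      then have "y i = y (- t) \<or> y i = y t" using 2 that(3) by blast
      then have "i = - t \<or> i = t" using y_small[OF i(1)] t by blast
      then show ?thesis using 2 \<open>v = y i\<close> t y_neq_x[of i i] by auto
    qed
  qed
  have rung: "j = i" if "\<bar>j\<bar> \<le> h" "v \<in> {x j, y j}" for j
    using that i x_neq_y y_neq_x x_small y_small by (metis insertE singletonD)
  show ?thesis
  proof (cases "\<bar>i\<bar> \<in> T")
    case True
    define e where "e = (if v = x i then {x (- \<bar>i\<bar>), x \<bar>i\<bar>} else {y (- \<bar>i\<bar>), y \<bar>i\<bar>})"
    have "e \<in> chords \<bar>i\<bar>" by (simp add: chords_def e_def)
    then have "e \<in> switched_rung T" using True unfolding switched_rung_def by blast
    moreover have "v \<in> e" using i(2) by (auto simp: e_def abs_if)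
    moreover have "e' = e" if "e' \<in> switched_rung T" "v \<in> e'" for e'
    proof -
      have "e' \<noteq> {x j, y j}" if "\<bar>j\<bar> \<le> h" "\<bar>j\<bar> \<notin> T" for j
      proof
        assume "e' = {x j, y j}"
        then have "j = i" using rung that(1) \<open>v \<in> e'\<close> by simp
        with that(2) True show False by simp
      qed
      then obtain t where "t \<in> T" "e' \<in> chords t"
        using \<open>e' \<in> switched_rung T\<close>
        unfolding switched_rung_def Un_iff mem_Collect_eq UN_iff by metis
      then show "e' = e" using chord[of t e'] that(2) unfolding e_def by blast
    qed
    ultimately show ?thesis by blast
  next
    case False
    then have "{x i, y i} \<in> switched_rung T"
      using i(1) unfolding switched_rung_def by blast
    moreover have "v \<in> {x i, y i}" using i(2) by blast
    moreover have "e' = {x i, y i}" if "e' \<in> switched_rung T" "v \<in> e'" for e'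
    proof -
      have "e' \<notin> chords t" if "t \<in> T" for t
        using chord[of t e'] that False \<open>v \<in> e'\<close> by blast
      then obtain j where "\<bar>j\<bar> \<le> h" "e' = {x j, y j}"
        using \<open>e' \<in> switched_rung T\<close>
        unfolding switched_rung_def Un_iff mem_Collect_eq UN_iff by metis
      then show ?thesis using rung[of j] that(2) by blast
    qed
    ultimately show ?thesis by blast
  qed
qed

section \<open>A Hamilton path growing outwards from index 0\<close>

text \<open>Each stage first extends the path at both ends by edges of \<open>rung 1\<close>, then
  adds two outer vertices. Attached directly, these use the rungs at plus and minus the new index;
  after reversing the inner path they use the chords. The new end vertices are the same either way,
  so the stages are independent.\<close>

primrec zigzag :: "int set \<Rightarrow> nat \<Rightarrow> 'a list" where
  "zigzag T 0 = [y 0, x 0]"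
| "zigzag T (Suc n) =
     (let l = x (- int (Suc n)) # zigzag T n @ [y (int (Suc n))]
      in y (- int (Suc n)) # (if int (Suc n) \<in> T then rev l else l) @ [x (int (Suc n))])"

lemma zigzag_ends:
  "zigzag T n \<noteq> []" "hd (zigzag T n) = y (- int n)" "last (zigzag T n) = x (int n)"
  subgoal by (cases n) (simp_all add: Let_def)
  subgoal by (cases n) (simp_all add: Let_def)
  subgoal by (cases n) (simp_all add: Let_def)
  done

lemma length_zigzag: "length (zigzag T n) = 4 * n + 2"
  by (induction n) (simp_all add: Let_def)

lemma atLeastAtMost_Suc_int:
  "{- int (Suc n)..int (Suc n)} = insert (- int (Suc n)) (insert (int (Suc n)) {- int n..int n})"
  by auto

lemma set_zigzag: "set (zigzag T n) = x ` {- int n..int n} \<union> y ` {- int n..int n}"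
proof (induction n)
  case (Suc n)
  then show ?case unfolding atLeastAtMost_Suc_int by (auto simp: Let_def)
qed auto

lemma path_edges_zigzag:
  assumes "T \<subseteq> {1..h}"
  shows "path_edges (zigzag T n) =
    {{x i, y i} | i. \<bar>i\<bar> \<le> int n \<and> \<bar>i\<bar> \<notin> T} \<union> (\<Union>t\<in>T \<inter> {..int n}. chords t) \<union>
    (\<lambda>i. {x i, y (i + 1)}) ` {- int n..<int n}"
    (is "_ = ?A n \<union> ?B n \<union> ?C n")
proof (induction n)
  case 0
  \<comment> \<open>Stage 0 consists of the rung at index 0 alone, which must not be
    switched.\<close>
  have "?B 0 = {}" "0 \<notin> T" using assms by auto
  then show ?case by (auto simp: insert_commute)
next
  case (Suc n)
  define m where "m = int (Suc n)"
  have n: "int n = m - 1" by (simp add: m_def)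
  have m: "m > 0" by (simp add: m_def)
  define l where "l = x (- m) # zigzag T n @ [y m]"
  \<comment> \<open>The two edges of \<open>rung 1\<close> gained at this stage do not depend on the
    orientation chosen afterwards.\<close>
  have l: "path_edges l = {{x (- m), y (- m + 1)}, {x (m - 1), y m}} \<union> path_edges (zigzag T n)"
    by (simp add: l_def path_edges_Cons path_edges_append zigzag_ends n)
  have C: "?C (Suc n) = {{x (- m), y (- m + 1)}, {x (m - 1), y m}} \<union> ?C n"
  proof -
    have "{- m..<m} = insert (- m) (insert (m - 1) {- (m - 1)..<m - 1})" using m by auto
    then show ?thesis using n by (simp flip: m_def)
  qed
  have l: "path_edges l = ?A n \<union> ?B n \<union> ?C (Suc n)"
    unfolding l C Suc.IH by (simp only: Un_ac)
  have ends: "l \<noteq> []" "hd l = x (- m)" "last l = y m" by (simp_all add: l_def)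
  have zz: "zigzag T (Suc n) = y (- m) # (if m \<in> T then rev l else l) @ [x m]"
    by (simp add: Let_def l_def m_def)
  have A: "?A (Suc n) = (if m \<in> T then {} else links m) \<union> ?A n"
  proof -
    have "\<bar>i\<bar> \<le> int (Suc n) \<longleftrightarrow> i = m \<or> i = - m \<or> \<bar>i\<bar> \<le> int n" for i
      unfolding m_def[symmetric] n using m by arith
    then show ?thesis using m by (auto simp: links_def)
  qed
  have B: "?B (Suc n) = (if m \<in> T then chords m else {}) \<union> ?B n"
  proof -
    have "{..int (Suc n)} = insert m {..int n}"
      unfolding m_def[symmetric] n by force
    then show ?thesis by simp
  qed
  have "path_edges (zigzag T (Suc n)) =
      (if m \<in> T then chords m else links m) \<union> path_edges l"
    unfolding zz using ends
    by (cases "m \<in> T") (auto simp: path_edges_Cons path_edges_append hd_rev last_rev chords_def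
        links_def insert_commute)
  then show ?case unfolding l A B by (simp add: Un_ac split: if_splits)
qed

text \<open>
  Replacing the rungs at \<open>\<plusminus>t\<close> by chords reverses a segment of the Hamilton cycle
  \<open>rung 0 \<union> rung 1\<close>. For different \<open>t\<close> these segments are nested, so all the replacements
  together still leave a single cycle.
\<close>

lemma ham_cycle_switched_rung:
  assumes T: "T \<subseteq> {1..h}"
  shows "ham_cycle_on V (switched_rung T \<union> rung 1)"
proof -
  define n where "n = nat h"
  have n: "int n = h" using h_pos by (simp add: n_def)
  have "set (zigzag T n) = V"
    unfolding set_zigzag V_def n
    by (simp only: range_periodic(1)[of x, OF x_eq] range_periodic(1)[of y, OF y_eq])
  moreover have "length (zigzag T n) = card V"
    using n p by (simp add: length_zigzag card_V)
  ultimately have ham: "ham_cycle_on V (cycle_edges (zigzag T n))"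
    using card_V_ge by (intro ham_cycle_onI) auto
  have "rung 1 = (\<lambda>i. {x i, y (i + 1)}) ` insert h {-h..<h}"
  proof -
    have "{x i, y (i + 1)} \<in> (\<lambda>i. {x i, y (i + 1)}) ` insert h {-h..<h}" for i
    proof -
      obtain j where j: "\<bar>j\<bar> \<le> h" "p dvd i - j" using ex_small .
      then have "{x i, y (i + 1)} = {x j, y (j + 1)}" using x_eq[of i j] y_eq[of "i + 1" "j + 1"] by simp
      moreover have "j \<in> insert h {-h..<h}" using j by auto
      ultimately show ?thesis by (rule image_eqI)
    qed
    then show ?thesis unfolding rung_def by blast
  qed
  \<comment> \<open>The path contains every edge of \<open>rung 1\<close> except the one at index
    \<open>h\<close>. As \<open>h + 1\<close> is congruent to \<open>- h\<close>, that one closes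
    the path.\<close>
  moreover have "y (h + 1) = y (- h)" using p by (simp add: y_eq)
  moreover have "T \<inter> {..h} = T" using T by auto
  ultimately have "cycle_edges (zigzag T n) = switched_rung T \<union> rung 1"
    by (simp add: cycle_edges_conv_path_edges zigzag_ends path_edges_zigzag[OF T] n
        switched_rung_def Un_assoc)
  with ham show ?thesis by simp
qed

section \<open>Decomposing unions of layers and rungs\<close>

context
  fixes T C :: "int set"
  assumes T: "T \<subseteq> {1..h}" and C: "C \<subseteq> {0..<p}"
begin

lemma rungs_disjoint_index: "i \<in> C \<Longrightarrow> j \<in> C \<Longrightarrow> i \<noteq> j \<Longrightarrow> \<not> p dvd i - j"
proof
  assume "i \<in> C" "j \<in> C" "i \<noteq> j" "p dvd i - j"
  then have "\<bar>p\<bar> \<le> \<bar>i - j\<bar>" by (intro dvd_imp_le_int) auto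
  moreover have "0 \<le> i" "i < p" "0 \<le> j" "j < p" using C \<open>i \<in> C\<close> \<open>j \<in> C\<close> by auto
  ultimately show False by linarith
qed

lemma finite_indices: "finite T" "finite C"
  using T C finite_subset by auto

lemma ham_decomp_switched:
  "ham_decomp_on V (card T) (\<Union>t\<in>T. (layers (2 * t) - chords t) \<union> links t)"
  using T not_dvd_small switched_disjoint finite_indices
  by (intro ham_decomp_on_UN ham_cycle_switched) blast+

lemma ham_decomp_rungs:
  assumes "I \<subseteq> C" "even (card I)"
  shows "ham_decomp_on V (card I div 2) (\<Union>c\<in>I. rung c)"
  using assms rungs_disjoint_index finite_indices finite_subset
  by (intro ham_decomp_on_UN_pairs ham_cycle_rungs rung_disjoint) blast+

text \<open>By \<open>switched_union\<close> the switched pieces consist of layer edges and edges of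
  \<open>rung 0\<close>, none of which lie on another rung.\<close>

lemma switched_rungs_disjoint:
  assumes "0 \<in> C" "I \<subseteq> C - {0}"
  shows "((\<Union>t\<in>T. (layers (2 * t) - chords t) \<union> links t) \<union> switched_rung T) \<inter> (\<Union>c\<in>I. rung c) = {}"
  unfolding switched_union[OF T]
  using layers_rung_disjoint rung_disjoint[of 0] rungs_disjoint_index[of 0] assms by blast

text \<open>The cycles are one for each element of \<open>T\<close>, one from the modified matching
  with \<open>rung 1\<close>, and one for each pair of the remaining \<open>card C - 2\<close>
  rungs.\<close>

lemma even_decomposition:
  assumes "0 \<in> C" "1 \<in> C" "even (card C)"
  shows "ham_decomp_on V (card T + card C div 2) ((\<Union>t\<in>T. layers (2 * t)) \<union> (\<Union>c\<in>C. rung c))"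
proof -
  define I where "I = C - {0, 1}"
  define L where "L = (\<Union>t\<in>T. (layers (2 * t) - chords t) \<union> links t)"
  have cI: "card C = card I + 2" "even (card I)"
  proof -
    have "C = insert 0 (insert 1 I)" "0 \<notin> insert 1 I" "1 \<notin> I" "finite I"
      using assms finite_indices by (auto simp: I_def)
    then show "card C = card I + 2" by simp
    with assms(3) show "even (card I)" by simp
  qed
  have "ham_decomp_on V (Suc 0) (switched_rung T \<union> rung 1)"
    using T by (intro ham_decomp_on_single ham_cycle_switched_rung)
  moreover have "(L \<union> switched_rung T) \<inter> rung 1 = {}"
    using switched_rungs_disjoint[of "{1}"] assms by (auto simp: L_def)
  moreover have "L \<inter> switched_rung T = {}"
    using switched_rung_disjoint[OF T] by (auto simp: L_def)
  ultimately have "ham_decomp_on V (card T + Suc 0) (L \<union> (switched_rung T \<union> rung 1))"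
    using ham_decomp_switched[folded L_def] by (intro ham_decomp_on_Un) blast+
  moreover have "rung 1 \<inter> (\<Union>c\<in>I. rung c) = {}"
    using rung_disjoint[of 1] rungs_disjoint_index[of 1] assms unfolding I_def by blast
  moreover have "(L \<union> switched_rung T) \<inter> (\<Union>c\<in>I. rung c) = {}"
    using switched_rungs_disjoint[of I] assms by (auto simp: L_def I_def)
  ultimately have "ham_decomp_on V (card T + Suc 0 + card I div 2)
      (L \<union> (switched_rung T \<union> rung 1) \<union> (\<Union>c\<in>I. rung c))"
    using cI(2) by (intro ham_decomp_on_Un[OF _ ham_decomp_rungs]) (auto simp: I_def)
  moreover have "L \<union> (switched_rung T \<union> rung 1) \<union> (\<Union>c\<in>I. rung c) =
      (\<Union>t\<in>T. layers (2 * t)) \<union> (\<Union>c\<in>C. rung c)"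
    using switched_union[OF T, folded L_def] assms(1,2) by (auto simp: I_def)
  ultimately show ?thesis using cI by simp
qed

text \<open>Here the modified matching is set aside, and the other \<open>card C - 1\<close> rungs,
  an even number, are paired.\<close>

lemma odd_decomposition:
  assumes "0 \<in> C" "odd (card C)"
  shows "ham_decomp_on V (card T + card C div 2)
    ((\<Union>t\<in>T. layers (2 * t)) \<union> (\<Union>c\<in>C. rung c) - switched_rung T)"
    and "switched_rung T \<subseteq> (\<Union>t\<in>T. layers (2 * t)) \<union> (\<Union>c\<in>C. rung c)"
proof -
  define I where "I = C - {0}"
  define L where "L = (\<Union>t\<in>T. (layers (2 * t) - chords t) \<union> links t)"
  have cI: "card C = Suc (card I)" "even (card I)"
    using assms(2) card.remove[OF finite_indices(2) assms(1)] by (simp_all add: I_def)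
  have dis: "(L \<union> switched_rung T) \<inter> (\<Union>c\<in>I. rung c) = {}"
    using switched_rungs_disjoint[of I] assms by (auto simp: L_def I_def)
  have "L \<inter> switched_rung T = {}"
    using switched_rung_disjoint[OF T] by (auto simp: L_def)
  have un: "L \<union> switched_rung T = (\<Union>t\<in>T. layers (2 * t)) \<union> rung 0"
    using switched_union[OF T] by (simp add: L_def)
  have C_eq: "C = insert 0 I" using assms by (auto simp: I_def)
  have "L \<union> (\<Union>c\<in>I. rung c) =
      (\<Union>t\<in>T. layers (2 * t)) \<union> (\<Union>c\<in>C. rung c) - switched_rung T"
    using un dis \<open>L \<inter> switched_rung T = {}\<close> by (auto simp: C_eq)
  moreover have "ham_decomp_on V (card T + card I div 2) (L \<union> (\<Union>c\<in>I. rung c))"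
    using cI dis ham_decomp_switched[folded L_def]
    by (intro ham_decomp_on_Un ham_decomp_rungs) (auto simp: I_def)
  ultimately show "ham_decomp_on V (card T + card C div 2)
    ((\<Union>t\<in>T. layers (2 * t)) \<union> (\<Union>c\<in>C. rung c) - switched_rung T)"
    using cI by simp
  show "switched_rung T \<subseteq> (\<Union>t\<in>T. layers (2 * t)) \<union> (\<Union>c\<in>C. rung c)"
    using un C_eq by auto
qed

end

end


section \<open>Cayley graphs of dihedral groups\<close>

text \<open>Sorting the edges by the element of \<open>S\<close> that produces them lets the edge
  set be computed one generator at a time.\<close>

lemma (in group) edges_cayley_graph:
  assumes "S \<subseteq> carrier G"
  shows "edges (cayley_graph G S) = {{g, s \<otimes> g} | g s. g \<in> carrier G \<and> s \<in> S}"
proof -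
  have "{g, h} \<in> {{g, s \<otimes> g} | g s. g \<in> carrier G \<and> s \<in> S}"
    if "g \<in> carrier G" "h \<in> carrier G" "h \<otimes> inv g \<in> S" for g h
  proof -
    have "{g, h} = {g, h \<otimes> inv g \<otimes> g}" using that by (simp add: m_assoc)
    with that(1,3) show ?thesis by (intro CollectI exI conjI)
  qed
  moreover have "s \<otimes> g \<in> carrier G \<and> s \<otimes> g \<otimes> inv g \<in> S" if "g \<in> carrier G" "s \<in> S" for g s
    using that subsetD[OF assms that(2)] by (simp add: m_assoc)
  then have "{g, s \<otimes> g} \<in> edges (cayley_graph G S)" if "g \<in> carrier G" "s \<in> S" for g s
    using that unfolding cayley_graph_def by fastforce
  ultimately show ?thesis unfolding cayley_graph_def by auto
qed

section \<open>Computing in the dihedral group\<close>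

lemma carrier_dihedral: "(i, s) \<in> carrier (dihedral n) \<longleftrightarrow> i \<in> {0..<int n}"
  by (simp add: dihedral_def)

lemma mult_dihedral:
  "(i, False) \<otimes>\<^bsub>dihedral n\<^esub> (j, s) = ((i + j) mod int n, s)"
  "(i, True) \<otimes>\<^bsub>dihedral n\<^esub> (j, s) = ((i - j) mod int n, \<not> s)"
  by (simp_all add: dihedral_def)

lemma one_dihedral: "\<one>\<^bsub>dihedral n\<^esub> = (0, False)"
  by (simp add: dihedral_def)

lemma inv_dihedral_rotation:
  assumes "n > 0" "i \<in> {0..<int n}"
  shows "inv\<^bsub>dihedral n\<^esub> (i, False) = ((- i) mod int n, False)"
proof -
  interpret D: group "dihedral n" using assms(1) by (rule dihedral_group)
  show ?thesis
    using assms by (intro D.inv_equality)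
      (auto simp: mult_dihedral one_dihedral carrier_dihedral mod_simps)
qed

text \<open>Rotations generate only rotations. The main proof uses this to find a reflection in
  \<open>S\<close>.\<close>

lemma generate_rotations:
  assumes "n > 0" "S \<subseteq> carrier (dihedral n)" "\<forall>g \<in> S. \<not> snd g"
    and "g \<in> generate (dihedral n) S"
  shows "\<not> snd g \<and> fst g \<in> {0..<int n}"
proof -
  have S: "\<not> snd g \<and> fst g \<in> {0..<int n}" if "g \<in> S" for g
  proof (cases g)
    case (Pair i s)
    then show ?thesis
      using subsetD[OF assms(2) that] bspec[OF assms(3) that] by (simp add: carrier_dihedral)
  qed
  show ?thesis
    using assms(4)
  proof (induction rule: generate.induct)
    case one
    then show ?case using assms(1) by (simp add: one_dihedral)
  next
    case (incl g)
    then show ?case using S by blast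
  next
    case (inv g)
    then obtain i where "g = (i, False)" "i \<in> {0..<int n}"
      using S by (metis (full_types) prod.collapse)
    then show ?case using assms(1) by (simp add: inv_dihedral_rotation)
  next
    case (eng g h)
    obtain i s j t where "g = (i, s)" "h = (j, t)" by fastforce
    with eng.IH show ?case using assms(1) by (auto simp: mult_dihedral)
  qed
qed

section \<open>The prime 2\<close>

text \<open>The group is the Klein four-group. Its three involutions give the three perfect
  matchings of the complete graph on four vertices, any two of which form a 4-cycle, and a
  generating \<open>S\<close> contains at least two of them.\<close>

lemma hamilton_decomposition_dihedral_2:
  assumes S: "S \<subseteq> carrier (dihedral 2)" "\<one>\<^bsub>dihedral 2\<^esub> \<notin> S" "S = set_inv\<^bsub>dihedral 2\<^esub> S"
    and gen: "generate (dihedral 2) S = carrier (dihedral 2)"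
  shows "hamilton_decomposition (cayley_graph (dihedral 2) S)"
proof -
  interpret D: group "dihedral 2" by (rule dihedral_group) simp
  let ?\<Gamma> = "cayley_graph (dihedral 2) S"
  define o' a b c :: "int \<times> bool"
    where "o' = (0, False)" and "a = (1, False)" and "b = (0, True)" and "c = (1, True)"
  note defs = o'_def a_def b_def c_def
  have carr: "carrier (dihedral 2) = {o', a, b, c}"
  proof -
    have "{0..<int 2} = {0, 1}" by auto
    then show ?thesis by (auto simp: dihedral_def defs UNIV_bool)
  qed
  have dist: "distinct [o', a, b, c]"
    by (simp add: defs)
  have card: "card {o', a, b, c} = 4" using dist by simp
  have inv: "inv\<^bsub>dihedral 2\<^esub> s = s" and sq: "s \<otimes>\<^bsub>dihedral 2\<^esub> s = o'" if "s \<in> {o', a, b, c}" for s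
  proof -
    show sq: "s \<otimes>\<^bsub>dihedral 2\<^esub> s = o'"
      using that by (auto simp: defs mult_dihedral)
    then show "inv\<^bsub>dihedral 2\<^esub> s = s"
      using that by (intro D.inv_equality) (simp_all add: carr one_dihedral o'_def)
  qed
  define M where "M s = {{g, s \<otimes>\<^bsub>dihedral 2\<^esub> g} | g. g \<in> {o', a, b, c}}" for s
  have M: "M a = {{o', a}, {b, c}}" "M b = {{o', b}, {a, c}}" "M c = {{o', c}, {a, b}}"
  proof -
    have M': "M s = (\<lambda>g. {g, s \<otimes>\<^bsub>dihedral 2\<^esub> g}) ` {o', a, b, c}" for s
      unfolding M_def by (rule Setcompr_eq_image)
    show "M a = {{o', a}, {b, c}}" "M b = {{o', b}, {a, c}}" "M c = {{o', c}, {a, b}}"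
      by (simp_all add: M' defs mult_dihedral insert_commute)
  qed
  have cycles: "M a \<union> M b = cycle_edges [o', a, c, b]"
    "M a \<union> M c = cycle_edges [o', a, b, c]" "M b \<union> M c = cycle_edges [o', b, a, c]"
    by (auto simp: M cycle_edges_conv_path_edges insert_commute)
  have edges: "edges ?\<Gamma> = (\<Union>s\<in>S. M s)"
    unfolding D.edges_cayley_graph[OF S(1)] carr M_def by blast
  have reg: "regular_graph ?\<Gamma> (card S)"
    using S by (intro D.cayley_graph_regular)
  have verts: "verts ?\<Gamma> = {o', a, b, c}" by (simp add: cayley_graph_def carr)
  have sub: "S \<subseteq> {a, b, c}" using S(1,2) carr by (auto simp: one_dihedral o'_def)
  \<comment> \<open>The identity and one involution form a subgroup of order 2, so a single
    involution cannot generate.\<close>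
  have nsub: "\<not> S \<subseteq> {s}" if "s \<in> {a, b, c}" for s
  proof
    assume "S \<subseteq> {s}"
    have "subgroup {o', s} (dihedral 2)"
    proof (rule D.subgroupI)
      show "{o', s} \<subseteq> carrier (dihedral 2)" using that carr by blast
      show "g \<otimes>\<^bsub>dihedral 2\<^esub> k \<in> {o', s}" if "g \<in> {o', s}" "k \<in> {o', s}" for g k
        using that \<open>s \<in> {a, b, c}\<close> sq[of s]
        by (auto simp: defs mult_dihedral)
    qed (use that inv in auto)
    then have "generate (dihedral 2) S \<subseteq> {o', s}"
      using \<open>S \<subseteq> {s}\<close> by (intro D.generate_subgroup_incl) auto
    then have "card {o', a, b, c} \<le> card {o', s}"
      unfolding gen carr by (intro card_mono) auto
    then show False using card card_insert_le_m1[of 2 "{s}" o'] by simp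
  qed
  have "S \<in> Pow {a, b, c}" using sub by blast
  then consider "S = {a, b}" | "S = {a, c}" | "S = {b, c}" | "S = {a, b, c}"
    using nsub[of a] nsub[of b] nsub[of c] by (auto simp: Pow_insert insert_commute)
  then show ?thesis
  proof cases
    case 4
    then have "c \<in> S" by simp
    then have "M c \<subseteq> edges ?\<Gamma>" unfolding edges by blast
    moreover have "\<forall>v\<in>{o', a, b, c}. \<exists>!e. e \<in> M c \<and> v \<in> e"
      unfolding M using dist by auto
    ultimately have "perfect_matching ?\<Gamma> (M c)"
      unfolding perfect_matching_def verts by blast
    moreover have "edges ?\<Gamma> - M c = cycle_edges [o', a, c, b]"
    proof -
      have "(\<Union>s\<in>S. M s) = (M a \<union> M b) \<union> M c" by (simp add: 4 Un_assoc)
      moreover have "(M a \<union> M b) \<inter> M c = {}" using dist by (auto simp: M doubleton_eq_iff)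
      ultimately have "edges ?\<Gamma> - M c = M a \<union> M b" unfolding edges by blast
      then show ?thesis using cycles(1) by simp
    qed
    then have "ham_decomp_on (verts ?\<Gamma>) 1 (edges ?\<Gamma> - M c)"
      using card by (simp add: verts) (intro ham_decomp_on_single ham_cycle_onI; auto)
    moreover have "card S = 2 * 1 + 1" using 4 dist by simp
    with reg have "regular_graph ?\<Gamma> (2 * 1 + 1)" by (simp only:)
    ultimately show ?thesis
      by (intro hamilton_decomposition_oddI) (auto simp: verts)
  next
    have *: ?thesis
      if "S = {s, t}" "s \<noteq> t" "M s \<union> M t = cycle_edges l" "length l = 4" "set l = {o', a, b, c}"
      for s t l
    proof -
      have "card S = 2 * 1" using that(1,2) by simp
      with reg have "regular_graph ?\<Gamma> (2 * 1)" by (simp only:)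
      moreover have "edges ?\<Gamma> = cycle_edges l"
        unfolding edges that(3)[symmetric] by (simp add: that(1))
      then have "ham_decomp_on (verts ?\<Gamma>) 1 (edges ?\<Gamma>)"
        using card that(4,5) ham_decomp_on_single[OF ham_cycle_onI, of l "{o', a, b, c}"]
        by (simp add: verts)
      ultimately show ?thesis by (intro hamilton_decomposition_evenI) simp_all
    qed
    {
      case 1
      then show ?thesis by (rule *[OF _ _ cycles(1)]) (use dist in auto)
    next
      case 2
      then show ?thesis by (rule *[OF _ _ cycles(2)]) (use dist in auto)
    next
      case 3
      then show ?thesis by (rule *[OF _ _ cycles(3)]) (use dist in auto)
    }
  qed
qed

section \<open>Odd primes: the Cayley graph as a union of layers and rungs\<close>

text \<open>The parameters fix coordinates: \<open>u\<close> scales the indices and \<open>b\<close>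
  places the reflection of exponent \<open>b\<close> at \<open>rung 0\<close>. The reflection of
  exponent \<open>b - u\<close> then becomes \<open>rung 1\<close>.\<close>

locale dihedral_cayley =
  fixes p :: nat and S :: "(int \<times> bool) set" and u b :: int
  assumes prime_p: "Factorial_Ring.prime p" and p_neq_2: "p \<noteq> 2"
    and S_subset: "S \<subseteq> carrier (dihedral p)"
    and one_notin: "\<one>\<^bsub>dihedral p\<^esub> \<notin> S"
    and S_inv: "S = set_inv\<^bsub>dihedral p\<^esub> S"
    and u: "\<not> int p dvd u"
begin

lemma p_pos: "p > 0" using prime_gt_0_nat[OF prime_p] .

sublocale D: group "dihedral p" using dihedral_group[OF p_pos] .

definition vx :: "int \<Rightarrow> int \<times> bool" where "vx i = ((u * i) mod int p, False)"
text \<open>Left multiplication by a reflection negates exponents. The minus sign undoes this, so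
  that a reflection shifts indices, sending \<open>vx i\<close> to
  \<open>vy (i + c)\<close>.\<close>

definition vy :: "int \<Rightarrow> int \<times> bool" where "vy i = ((b - u * i) mod int p, True)"
definition H :: int where "H = (int p - 1) div 2"

lemma dvd_u_mult: "int p dvd u * i \<longleftrightarrow> int p dvd i"
  using prime_dvd_mult_iff[of "int p" u i] prime_p u by simp

sublocale two_layers "int p" H vx vy
proof
  show "Factorial_Ring.prime (int p)" using prime_p by simp
  have "odd p" using prime_p p_neq_2 prime_odd_nat prime_ge_2_nat by (metis le_neq_implies_less)
  then show "int p = 2 * H + 1" unfolding H_def by (auto elim!: oddE)
  show "vx i = vx j \<longleftrightarrow> int p dvd i - j" for i j
    using dvd_u_mult[of "i - j"] by (simp add: vx_def mod_eq_dvd_iff right_diff_distrib)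
  show "vy i = vy j \<longleftrightarrow> int p dvd i - j" for i j
    using dvd_u_mult[of "j - i"]
    by (simp add: vy_def mod_eq_dvd_iff right_diff_distrib dvd_diff_commute)
  show "vx i \<noteq> vy j" for i j by (simp add: vx_def vy_def)
qed

lemma carrier_eq_V: "carrier (dihedral p) = V"
proof (rule card_seteq[symmetric])
  show "V \<subseteq> carrier (dihedral p)"
    using p_pos by (auto simp: V_def vx_def vy_def carrier_dihedral)
  show "finite (carrier (dihedral p))" by (simp add: dihedral_def)
  show "card (carrier (dihedral p)) \<le> card V"
    using dihedral_order[of p] by (simp add: order_def card_V)
qed

definition R :: "int set" where "R = {i. (i, False) \<in> S}"
definition F :: "int set" where "F = {i. (i, True) \<in> S}"
text \<open>There is one \<open>t\<close> for each pair of inverse rotations, whereas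
  \<open>C\<close> has one offset for each reflection; hence the valency
  \<open>2 * card T + card C\<close>.\<close>

definition T :: "int set" where "T = {t \<in> {1..H}. (u * (2 * t)) mod int p \<in> R}"
definition C :: "int set" where "C = {c \<in> {0..<int p}. (b - u * c) mod int p \<in> F}"

lemma T_subset: "T \<subseteq> {1..H}" and C_subset: "C \<subseteq> {0..<int p}"
  by (auto simp: T_def C_def)

lemma R_subset: "R \<subseteq> {0..<int p}" "0 \<notin> R" and F_subset: "F \<subseteq> {0..<int p}"
  using S_subset one_notin by (auto simp: R_def F_def carrier_dihedral one_dihedral)

lemma R_minus: "i \<in> R \<Longrightarrow> (- i) mod int p \<in> R"
proof -
  assume i: "i \<in> R"
  then have "inv\<^bsub>dihedral p\<^esub> (i, False) \<in> set_inv\<^bsub>dihedral p\<^esub> S"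
    unfolding R_def SET_INV_def by blast
  then have "inv\<^bsub>dihedral p\<^esub> (i, False) \<in> S" using S_inv by simp
  moreover have "i \<in> {0..<int p}" using i R_subset by blast
  ultimately show ?thesis using inv_dihedral_rotation[OF p_pos, of i] by (simp add: R_def)
qed

lemma image_C: "(\<lambda>c. (b - u * c) mod int p) ` C = F"
proof
  show "F \<subseteq> (\<lambda>c. (b - u * c) mod int p) ` C"
  proof
    fix f assume f: "f \<in> F"
    then have "f mod int p = f" using F_subset by auto
    obtain k where k: "k < nat (int p)" "int p dvd (b - f) - (int k * u + 0)"
      using ex_multiple[OF u] by metis
    have "(b - u * int k) mod int p = f mod int p"
      using k(2) by (simp add: mod_eq_dvd_iff algebra_simps)
    then have "(b - u * int k) mod int p = f" using \<open>f mod int p = f\<close> by simp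
    moreover from this have "int k \<in> C" using k(1) f by (simp add: C_def)
    ultimately show "f \<in> (\<lambda>c. (b - u * c) mod int p) ` C" by (metis image_eqI)
  qed
qed (auto simp: C_def)

lemma card_C: "card C = card F"
proof -
  have "inj_on (\<lambda>c. (b - u * c) mod int p) C"
  proof (rule inj_onI)
    fix c d assume cd: "c \<in> C" "d \<in> C" "(b - u * c) mod int p = (b - u * d) mod int p"
    then have "int p dvd c - d" using y_eq[of c d] by (simp add: vy_def)
    then show "c = d" using rungs_disjoint_index[OF T_subset C_subset] cd by blast
  qed
  then show ?thesis using image_C by (metis card_image)
qed

definition rot :: "int \<Rightarrow> int" where "rot t = (u * (2 * t)) mod int p"

lemma rot_eq_iff: "rot s = rot t \<longleftrightarrow> int p dvd s - t"
  using dvd_u_mult[of "2 * (s - t)"] dvd_2_mult[of "s - t"]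
  by (simp add: rot_def mod_eq_dvd_iff right_diff_distrib)

text \<open>Since \<open>2 * u\<close> is invertible modulo \<open>p\<close>, each rotation exponent
  is \<open>rot t\<close> with \<open>t\<close> between \<open>-H\<close> and \<open>H\<close>. It
  is nonzero because the identity is not in \<open>S\<close>.\<close>

lemma R_eq: "R = rot ` T \<union> (\<lambda>t. rot (- t)) ` T"
proof
  have "rot (- t) \<in> R" if "t \<in> T" for t
    using R_minus[of "rot t"] that by (simp add: T_def rot_def mod_minus_eq)
  then show "rot ` T \<union> (\<lambda>t. rot (- t)) ` T \<subseteq> R" by (auto simp: T_def rot_def)
  show "R \<subseteq> rot ` T \<union> (\<lambda>t. rot (- t)) ` T"
  proof
    fix i assume i: "i \<in> R"
    then have imod: "i mod int p = i" using R_subset by auto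
    have u2: "\<not> int p dvd u * 2" using dvd_u_mult not_dvd_2 by blast
    obtain k where "int p dvd i - (int k * (u * 2) + 0)" using ex_multiple[OF u2] by metis
    obtain t where t: "\<bar>t\<bar> \<le> H" "int p dvd int k - t" using ex_small .
    have "i = rot (int k)"
      using \<open>int p dvd i - (int k * (u * 2) + 0)\<close> imod
      by (metis (no_types, opaque_lifting) add.right_neutral mod_eq_dvd_iff mult.assoc mult.commute rot_def)
    then have it: "i = rot t" using t(2) rot_eq_iff by simp
    have "t \<noteq> 0" using it i R_subset(2) by (auto simp: rot_def)
    show "i \<in> rot ` T \<union> (\<lambda>t. rot (- t)) ` T"
    proof (cases "t > 0")
      case True
      then have "t \<in> T" using t it i by (simp add: T_def rot_def)
      then show ?thesis using it by blast
    next
      case False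
      \<comment> \<open>A negative \<open>t\<close> is replaced by \<open>- t\<close>, which
        qualifies because \<open>S\<close> is closed under inverses.\<close>
      have "rot (- t) = (- i) mod int p" by (simp add: it rot_def mod_minus_eq)
      then have "- t \<in> T"
        using False t R_minus[OF i] \<open>t \<noteq> 0\<close> by (simp add: T_def rot_def)
      then have "rot (- (- t)) \<in> (\<lambda>t. rot (- t)) ` T" by (rule imageI)
      then show ?thesis using it by simp
    qed
  qed
qed

lemma card_R: "card R = 2 * card T"
proof -
  have "inj_on rot T" "inj_on (\<lambda>t. rot (- t)) T"
  proof -
    have "s = t" if "s \<in> T" "t \<in> T" "int p dvd s - t \<or> int p dvd t - s" for s t
    proof -
      have "\<bar>s\<bar> \<le> H" "\<bar>t\<bar> \<le> H" using T_subset that(1,2) by auto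
      then show ?thesis using dvd_diff_small[of s t] dvd_diff_small[of t s] that(3) by auto
    qed
    then show "inj_on rot T" "inj_on (\<lambda>t. rot (- t)) T"
      by (simp_all add: inj_on_def rot_eq_iff)
  qed
  moreover have "rot ` T \<inter> (\<lambda>t. rot (- t)) ` T = {}"
  proof -
    have "rot s \<noteq> rot (- t)" if "s \<in> T" "t \<in> T" for s t
    proof
      assume "rot s = rot (- t)"
      moreover have "s \<in> {1..H}" "t \<in> {1..H}" using that T_subset by auto
      ultimately show False using dvd_diff_small[of s "- t"] by (auto simp: rot_eq_iff)
    qed
    then show ?thesis by blast
  qed
  ultimately show ?thesis
    using finite_indices[OF T_subset C_subset] by (simp add: R_eq card_Un_disjoint card_image)
qed

lemma card_S: "card S = 2 * card T + card C"
proof -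
  have "S = R \<times> {False} \<union> F \<times> {True}" 
  proof (rule Set.set_eqI)
    show "z \<in> S \<longleftrightarrow> z \<in> R \<times> {False} \<union> F \<times> {True}" for z
      by (cases z; cases "snd z") (auto simp: R_def F_def)
  qed
  then have "card S = card (R \<times> {False} \<union> F \<times> {True})" by (rule arg_cong)
  moreover have "finite R" "finite F" using R_subset F_subset finite_subset by blast+
  ultimately show ?thesis
    by (subst (asm) card_Un_disjoint) (auto simp: card_cartesian_product card_R card_C)
qed

lemma rotation_X: "(rot t, False) \<otimes>\<^bsub>dihedral p\<^esub> vx i = vx (i + 2 * t)"
  by (simp add: rot_def vx_def mult_dihedral mod_simps algebra_simps)

lemma rotation_Y: "(rot t, False) \<otimes>\<^bsub>dihedral p\<^esub> vy i = vy (i - 2 * t)"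
  by (simp add: rot_def vy_def mult_dihedral mod_simps algebra_simps)

lemma reflection_X: "((b - u * c) mod int p, True) \<otimes>\<^bsub>dihedral p\<^esub> vx i = vy (i + c)"
  by (simp add: vx_def vy_def mult_dihedral mod_simps algebra_simps)

lemma reflection_Y: "((b - u * c) mod int p, True) \<otimes>\<^bsub>dihedral p\<^esub> vy i = vx (i - c)"
  by (simp add: vx_def vy_def mult_dihedral mod_diff_eq) (simp add: algebra_simps)

text \<open>A rotation shifts the two layers in opposite directions. Edges are unordered, so
  reindexing layer \<open>y\<close> by \<open>2 * t\<close> removes the difference.\<close>

lemma edges_rotation:
  "{{g, (rot t, False) \<otimes>\<^bsub>dihedral p\<^esub> g} | g. g \<in> V} = layers (2 * t)"
proof -
  have "{vy i, vy (i - 2 * t)} \<in> range (\<lambda>i. {vy i, vy (i + 2 * t)})" for i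
    by (rule image_eqI[of _ _ "i - 2 * t"]) (simp_all add: insert_commute)
  moreover have "{vy i, vy (i + 2 * t)} \<in> range (\<lambda>i. {vy i, vy (i - 2 * t)})" for i
    by (rule image_eqI[of _ _ "i + 2 * t"]) (simp_all add: insert_commute)
  ultimately have "range (\<lambda>i. {vy i, vy (i - 2 * t)}) = range (\<lambda>i. {vy i, vy (i + 2 * t)})"
    by (intro equalityI image_subsetI)
  moreover have "{{g, (rot t, False) \<otimes>\<^bsub>dihedral p\<^esub> g} | g. g \<in> V} =
      range (\<lambda>i. {vx i, vx (i + 2 * t)}) \<union> range (\<lambda>i. {vy i, vy (i - 2 * t)})"
    unfolding Setcompr_eq_image V_def image_Un image_image rotation_X rotation_Y ..
  ultimately show ?thesis by (simp add: layers_def)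
qed

lemma layers_minus: "layers (- d) = layers d"
proof -
  have "layers (- d) \<subseteq> layers d" for d
  proof -
    have "{vx i, vx (i + - d)} \<in> range (\<lambda>i. {vx i, vx (i + d)})"
      "{vy i, vy (i + - d)} \<in> range (\<lambda>i. {vy i, vy (i + d)})" for i
      by (rule image_eqI[of _ _ "i - d"]; simp add: insert_commute)+
    then show ?thesis unfolding layers_def by blast
  qed
  from this[of d] this[of "- d"] show ?thesis by simp
qed

text \<open>The edges listed from layer \<open>y\<close> repeat those listed from layer
  \<open>x\<close>, so a reflection contributes one matching.\<close>

lemma edges_reflection:
  "{{g, ((b - u * c) mod int p, True) \<otimes>\<^bsub>dihedral p\<^esub> g} | g. g \<in> V} = rung c"
proof -
  have "{vy i, vx (i - c)} \<in> rung c" for i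
    unfolding rung_def by (rule image_eqI[of _ _ "i - c"]) (simp_all add: insert_commute)
  then have "range (\<lambda>i. {vy i, vx (i - c)}) \<subseteq> rung c" by blast
  moreover have "{{g, ((b - u * c) mod int p, True) \<otimes>\<^bsub>dihedral p\<^esub> g} | g. g \<in> V} =
      range (\<lambda>i. {vx i, vy (i + c)}) \<union> range (\<lambda>i. {vy i, vx (i - c)})"
    unfolding Setcompr_eq_image V_def image_Un image_image reflection_X reflection_Y ..
  ultimately show ?thesis unfolding rung_def by (simp only: Un_absorb2)
qed

lemma edges_eq:
  "edges (cayley_graph (dihedral p) S) = (\<Union>t\<in>T. layers (2 * t)) \<union> (\<Union>c\<in>C. rung c)"
proof -
  define E where "E s = {{g, s \<otimes>\<^bsub>dihedral p\<^esub> g} | g. g \<in> V}" for s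
  have F_eq: "F = (\<lambda>c. (b - u * c) mod int p) ` C" using image_C by simp
  have "edges (cayley_graph (dihedral p) S) = (\<Union>s\<in>S. E s)"
    unfolding D.edges_cayley_graph[OF S_subset] carrier_eq_V E_def by blast
  also have "\<dots> = (\<Union>i\<in>R. E (i, False)) \<union> (\<Union>i\<in>F. E (i, True))"
  proof -
    have "z \<in> S \<longleftrightarrow> z \<in> (\<lambda>i. (i, False)) ` R \<union> (\<lambda>i. (i, True)) ` F" for z
      by (cases z; cases "snd z") (auto simp: R_def F_def)
    then have "S = (\<lambda>i. (i, False)) ` R \<union> (\<lambda>i. (i, True)) ` F" by blast
    then have "(\<Union>s\<in>S. E s) = (\<Union>s\<in>(\<lambda>i. (i, False)) ` R \<union> (\<lambda>i. (i, True)) ` F. E s)"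
      by (rule arg_cong)
    then show ?thesis by (simp only: UN_Un UN_simps image_Un Union_Un_distrib image_image)
  qed
  also have "\<dots> = (\<Union>t\<in>T. E (rot t, False)) \<union> (\<Union>t\<in>T. E (rot (- t), False)) \<union>
      (\<Union>c\<in>C. E ((b - u * c) mod int p, True))"
    by (simp only: R_eq F_eq UN_Un UN_simps image_Un Union_Un_distrib image_image)
  also have "\<dots> = (\<Union>t\<in>T. layers (2 * t)) \<union> (\<Union>c\<in>C. rung c)"
    unfolding E_def edges_rotation edges_reflection by (simp add: layers_minus)
  finally show ?thesis .
qed

lemma verts_eq: "verts (cayley_graph (dihedral p) S) = V"
  by (simp add: cayley_graph_def carrier_eq_V)

lemma regular: "regular_graph (cayley_graph (dihedral p) S) (2 * card T + card C)"
  using D.cayley_graph_regular[OF S_subset one_notin S_inv] by (simp add: card_S)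

lemma hamilton_decomposition_odd:
  assumes "0 \<in> C" "odd (card C)"
  shows "hamilton_decomposition (cayley_graph (dihedral p) S)"
proof (rule hamilton_decomposition_oddI)
  have "2 * card T + card C = 2 * (card T + card C div 2) + 1" using assms(2) by presburger
  then show "regular_graph (cayley_graph (dihedral p) S) (2 * (card T + card C div 2) + 1)"
    using regular by (simp only:)
  show "perfect_matching (cayley_graph (dihedral p) S) (switched_rung T)"
    unfolding perfect_matching_def verts_eq edges_eq
    using odd_decomposition(2)[OF T_subset C_subset assms] switched_rung_matching[OF T_subset]
    by blast
  show "verts (cayley_graph (dihedral p) S) \<noteq> {}" by (auto simp: verts_eq V_def)
  show "ham_decomp_on (verts (cayley_graph (dihedral p) S)) (card T + card C div 2)
      (edges (cayley_graph (dihedral p) S) - switched_rung T)"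
    unfolding verts_eq edges_eq by (rule odd_decomposition(1)[OF T_subset C_subset assms])
qed

lemma hamilton_decomposition_even:
  assumes "0 \<in> C" "1 \<in> C" "even (card C)"
  shows "hamilton_decomposition (cayley_graph (dihedral p) S)"
proof (rule hamilton_decomposition_evenI)
  have "2 * card T + card C = 2 * (card T + card C div 2)" using assms(3) by presburger
  then show "regular_graph (cayley_graph (dihedral p) S) (2 * (card T + card C div 2))"
    using regular by (simp only:)
  have "card C > 0"
    using assms(1) finite_indices[OF T_subset C_subset] card_gt_0_iff by blast
  then show "card T + card C div 2 \<ge> 1" using assms(3) by presburger
  show "ham_decomp_on (verts (cayley_graph (dihedral p) S)) (card T + card C div 2)
      (edges (cayley_graph (dihedral p) S))"
    unfolding verts_eq edges_eq by (rule even_decomposition[OF T_subset C_subset assms])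
qed

end

section \<open>The choice of coordinates\<close>

theorem theorem2:
  fixes p :: nat and S :: "(int \<times> bool) set"
  assumes "Factorial_Ring.prime p"
    and "S \<subseteq> carrier (dihedral p)"
    and "\<one>\<^bsub>dihedral p\<^esub> \<notin> S"
    and "S = set_inv\<^bsub>dihedral p\<^esub> S"
    and "generate (dihedral p) S = carrier (dihedral p)"
  shows "hamilton_decomposition (cayley_graph (dihedral p) S)"
proof (cases "p = 2")
  case True
  show ?thesis
    using assms(2-5) unfolding True by (rule hamilton_decomposition_dihedral_2)
next
  case False
  have p: "p > 1" using prime_gt_1_nat[OF assms(1)] .
  define K where "K = {i. (i, True) \<in> S}"
  have K: "K \<subseteq> {0..<int p}" using assms(2) by (auto simp: K_def carrier_dihedral)
  then have "finite K" using finite_subset by blast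
  have "(0, True) \<in> generate (dihedral p) S"
    using p by (simp add: assms(5) carrier_dihedral)
  then have "\<not> (\<forall>g \<in> S. \<not> snd g)"
    using generate_rotations[of p S "(0, True)"] p assms(2) by auto
  then obtain b where b: "b \<in> K" by (auto simp: K_def)
  have b_mod: "i mod int p = i" if "i \<in> K" for i using that K by auto
  show ?thesis
  proof (cases "even (card K)")
    case True
    \<comment> \<open>A positive even number of reflections supplies a second one,
      \<open>d\<close>.\<close>
    have "card K > 0" using b \<open>finite K\<close> card_gt_0_iff by blast
    with True have "card K \<noteq> 1" "card K \<noteq> 0" by auto
    then have "K \<noteq> {b}" by auto
    then obtain d where d: "d \<in> K" "d \<noteq> b" using b by blast
    have "\<not> int p dvd b - d"
      using b_mod[OF b] b_mod[OF d(1)] d(2) by (metis mod_eq_dvd_iff)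
    \<comment> \<open>With \<open>u = b - d\<close>, the offsets 0 and 1 belong to the reflections
      of exponents \<open>b\<close> and \<open>d\<close>, so both lie in \<open>C\<close>.\<close>
    then interpret dihedral_cayley p S "b - d" b
      using assms False by unfold_locales
    have "K = F" by (simp add: K_def F_def)
    have "0 \<in> C" "1 \<in> C"
      using b d p b_mod h_pos by (simp_all add: C_def flip: \<open>K = F\<close>)
    with True show ?thesis
      using hamilton_decomposition_even by (simp add: card_C flip: \<open>K = F\<close>)
  next
    case odd: False
    \<comment> \<open>For an odd number only offset 0 is prescribed, so the indices need no
      scaling.\<close>
    have "\<not> int p dvd 1" using p by simp
    then interpret dihedral_cayley p S 1 b
      using assms False by unfold_locales
    have "K = F" by (simp add: K_def F_def)
    have "0 \<in> C"
      using b p b_mod by (simp add: C_def flip: \<open>K = F\<close>)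
    with odd show ?thesis
      using hamilton_decomposition_odd by (simp add: card_C flip: \<open>K = F\<close>)
  qed
qed

end
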